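(* Suppose that the composition law $\#$ on $\mathcal S(\Xi)$ satisfies Hypotheses A, B and C. Let $\mathfrak L$ be a Banach space continuously embedded in $\mathcal S'(\Xi\times\Xi)$, and let $\mathbb M:\mathcal S'(\Xi\times\Xi)\to\mathcal S'(\Xi\times\Xi)$ be a topological linear isomorphism. Assume that the isomorphism $\mathbf M\circ\mathbb M^{-1}$ of $\mathcal S'(\Xi\times\Xi)$ restricts to a bijection $\mathfrak L\to\mathfrak L$. Then, for every $h\in\mathcal S(\Xi)\setminus\{0\}$, the two subspaces $\mathfrak L^{\mathbb M}_h$ and $\mathfrak L^{\mathbf M}_h$ of $\mathcal S'(\Xi)$ coincide and have equivalent Banach norms.
   Context: Notation. Let $\Xi=\mathbb R^n\times\mathbb R^n$ with points $X=(x,\xi)$, $Y=(y,\eta)$ and symplectic form $\sigma(X,Y)=y\cdot\xi-x\cdot\eta$. $dX$ denotes Lebesgue measure on $\Xi$ multiplied by $(2\pi)^{-n}$, so that the symplectic Fourier transform $(\mathfrak Ff)(Y)=\widehat f(Y)=\int_\Xi e^{-i\sigma(Y,Z)}f(Z)\,dZ$ is unitary in $L^2(\Xi)$ and $\mathfrak F^2=1$. $\langle f,g\rangle=\int_\Xi f(X)g(X)\,dX$ (bilinear), and the same symbol denotes the duality between $\mathcal S'(\Xi)$ and $\mathcal S(\Xi)$ (in either order). Similarly $\langle\!\langle F,G\rangle\!\rangle=\int_\Xi\int_\Xi F(X,Y)G(X,Y)\,dX\,dY$ and its extension to a duality between $\mathcal S'(\Xi\times\Xi)$ and $\mathcal S(\Xi\times\Xi)$.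 Spaces of tempered distributions carry the strong dual topology. Functions are complex valued. $\mathbf e_X(Z):=e^{i\sigma(X,Z)}$ for $X,Z\in\Xi$. Hypothesis A. $\#:\mathcal S(\Xi)\times\mathcal S(\Xi)\to\mathcal S(\Xi)$ is bilinear, associative and separately continuous, $\mathcal S(\Xi)$ is a $^*$-algebra with the product $\#$ and the involution $f^\#:=\overline f$ (so $\overline{f\#g}=\overline g\#\overline f$), and $\int_\Xi (f\#g)(X)\,dX=\int_\Xi f(X)g(X)\,dX$ for all $f,g\in\mathcal S(\Xi)$. Extension. Under Hypothesis A, for $f\in\mathcal S'(\Xi)$, $g\in\mathcal S(\Xi)$, the distributions $f\#g,\ g\#f\in\mathcal S'(\Xi)$ are defined by $\langle f\#g,h\rangle:=\langle f,g\#h\rangle$ and $\langle g\#f,h\rangle:=\langle f,h\#g\rangle$ for $h\in\mathcal S(\Xi)$; these extend $\#$ and satisfy $(f_1\#g)\#f_2=f_1\#(g\#f_2)$ for $f_1,f_2\in\mathcal S(\Xi)$, $g\in\mathcal S'(\Xi)$. Hypothesis B. $f_1\#g\#f_2\in\mathcal S(\Xi)$ for all $f_1,f_2\in\mathcal S(\Xi)$, $g\in\mathcal S'(\Xi)$. Under Hypothesis B one sets, for $g_1,g_2\in\mathcal S'(\Xi)$ and $f,h\in\mathcal S(\Xi)$, $\langle g_1\#f\#g_2,h\rangle:=\langle g_1,f\#g_2\#h\rangle$, which defines $g_1\#f\#g_2\in\mathcal S'(\Xi)$. Hypothesis C. With $\Theta^\#_Z(f):=\mathbf e_{-Z}\#f\#\mathbf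 e_Z$, for all $f,g\in\mathcal S(\Xi)$ one has $\int_\Xi \langle\Theta^\#_Z(f),g\rangle\,dZ=\int_\Xi f(Z)\,dZ\int_\Xi g(Y)\,dY$. The modulation mapping. $\mathbf N:\mathcal S(\Xi\times\Xi)\to\mathcal S'(\Xi\times\Xi)$ is the linear continuous map uniquely determined, for all $f_1,f_2,g_1,g_2\in\mathcal S(\Xi)$, by $\langle\!\langle\mathbf N(f_1\otimes f_2),g_1\otimes g_2\rangle\!\rangle=\langle\widehat g_1\#f_1,\widehat g_2\#f_2\rangle$, and $\mathbf M:=\mathbf C\circ\mathbf N$, where $\mathbf C(F):=F\circ C$ and $C(X,Y):=(-X,X-Y)$. One has $[\mathbf M(f\otimes g)](X,Y)=\langle\mathbf e_{-X}\#f,\mathbf e_{X-Y}\#g\rangle:=\langle\mathbf e_{-X},f\#\mathbf e_{X-Y}\#g\rangle$ for $f,g\in\mathcal S(\Xi)$. Under Hypotheses A, B, C, $\mathbf M$ is a topological isomorphism of $\mathcal S(\Xi\times\Xi)$ and extends uniquely to a topological isomorphism of $\mathcal S'(\Xi\times\Xi)$, still denoted $\mathbf M$. Induced spaces. For $h\in\mathcal S(\Xi)\setminus\{0\}$ and $f\in\mathcal S'(\Xi)$ set $\mathbf M_h(f):=\mathbf M(f\otimes h)$ and $\mathbb M_h(f):=\mathbb M(f\otimes h)$. Then $\mathfrak L^{\mathbf M}_h:=\mathbf M_h^{-1}(\mathfrak L)$ with norm $\|f\|_{\mathfrak L^{\mathbf M}_h}:=\|\mathbf M_h(f)\|_{\mathfrak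 L}$, and $\mathfrak L^{\mathbb M}_h:=\mathbb M_h^{-1}(\mathfrak L)$ with norm $\|f\|_{\mathfrak L^{\mathbb M}_h}:=\|\mathbb M_h(f)\|_{\mathfrak L}$; both are Banach spaces. *)

theory Defs
  imports "HOL-Analysis.Analysis" "HOL-Library.Function_Algebras"
begin

section \<open>Complex vector spaces of functions, seminorms, Banach norms\<close>

text \<open>All vector spaces below (of Schwartz functions, and of functionals on them) are sets of
  complex valued functions with the pointwise operations.\<close>

abbreviation cscale :: "complex \<Rightarrow> ('a \<Rightarrow> complex) \<Rightarrow> 'a \<Rightarrow> complex"
  where "cscale c f \<equiv> (\<lambda>x. c * f x)"

interpretation cfun: vector_space cscale
  by unfold_locales (simp_all add: fun_eq_iff distrib_left distrib_right)

definition clinear_on :: "('a \<Rightarrow> complex) set \<Rightarrow> (('a \<Rightarrow> complex) \<Rightarrow> ('b \<Rightarrow> complex)) \<Rightarrow> bool"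
  where "clinear_on V T \<longleftrightarrow>
    (\<forall>u\<in>V. \<forall>v\<in>V. T (u + v) = T u + T v) \<and> (\<forall>c. \<forall>u\<in>V. T (cscale c u) = cscale c (T u))"

definition seminorm_topology :: "'v::minus set \<Rightarrow> ('v \<Rightarrow> real) set \<Rightarrow> 'v topology"
  where "seminorm_topology V P = topology (\<lambda>U. U \<subseteq> V \<and>
    (\<forall>f\<in>U. \<exists>Q \<epsilon>. finite Q \<and> Q \<subseteq> P \<and> \<epsilon> > 0 \<and> {g \<in> V. \<forall>p\<in>Q. p (g - f) < \<epsilon>} \<subseteq> U))"

lemma openin_seminorm_topology:
  "openin (seminorm_topology V P) U \<longleftrightarrow> U \<subseteq> V \<and>
    (\<forall>f\<in>U. \<exists>Q \<epsilon>. finite Q \<and> Q \<subseteq> P \<and> \<epsilon> > 0 \<and> {g \<in> V. \<forall>p\<in>Q. p (g - f) < \<epsilon>} \<subseteq> U)"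
proof -
  let ?O = "\<lambda>U. U \<subseteq> V \<and>
    (\<forall>f\<in>U. \<exists>Q \<epsilon>. finite Q \<and> Q \<subseteq> P \<and> \<epsilon> > 0 \<and> {g \<in> V. \<forall>p\<in>Q. p (g - f) < \<epsilon>} \<subseteq> U)"
  have "istopology ?O"
    unfolding istopology_def
  proof (intro conjI allI impI)
    fix S T assume S: "?O S" and T: "?O T"
    show "S \<inter> T \<subseteq> V" using S by blast
    show "\<forall>f\<in>S \<inter> T. \<exists>Q \<epsilon>. finite Q \<and> Q \<subseteq> P \<and> \<epsilon> > 0 \<and> {g \<in> V. \<forall>p\<in>Q. p (g - f) < \<epsilon>} \<subseteq> S \<inter> T"
    proof
      fix f assume "f \<in> S \<inter> T"
      then have "f \<in> S" "f \<in> T" by simp_all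
      from S \<open>f \<in> S\<close> obtain Q \<epsilon> where
        Q: "finite Q" "Q \<subseteq> P" "\<epsilon> > 0" "{g \<in> V. \<forall>p\<in>Q. p (g - f) < \<epsilon>} \<subseteq> S"
        by blast
      from T \<open>f \<in> T\<close> obtain Q' \<epsilon>' where
        Q': "finite Q'" "Q' \<subseteq> P" "\<epsilon>' > 0" "{g \<in> V. \<forall>p\<in>Q'. p (g - f) < \<epsilon>'} \<subseteq> T"
        by blast
      have "{g \<in> V. \<forall>p\<in>Q \<union> Q'. p (g - f) < min \<epsilon> \<epsilon>'} \<subseteq> S \<inter> T"
      proof
        fix g assume "g \<in> {g \<in> V. \<forall>p\<in>Q \<union> Q'. p (g - f) < min \<epsilon> \<epsilon>'}"
        then have "g \<in> {g \<in> V. \<forall>p\<in>Q. p (g - f) < \<epsilon>}" "g \<in> {g \<in> V. \<forall>p\<in>Q'. p (g - f) < \<epsilon>'}"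
          by simp_all
        then show "g \<in> S \<inter> T" using Q(4) Q'(4) by blast
      qed
      moreover have "finite (Q \<union> Q')" "Q \<union> Q' \<subseteq> P" "min \<epsilon> \<epsilon>' > 0"
        using Q Q' by simp_all
      ultimately show "\<exists>Q \<epsilon>. finite Q \<and> Q \<subseteq> P \<and> \<epsilon> > 0 \<and> {g \<in> V. \<forall>p\<in>Q. p (g - f) < \<epsilon>} \<subseteq> S \<inter> T"
        by (intro exI conjI)
    qed
  next
    fix K assume K: "\<forall>S\<in>K. ?O S"
    show "\<Union>K \<subseteq> V" using K by blast
    show "\<forall>f\<in>\<Union>K. \<exists>Q \<epsilon>. finite Q \<and> Q \<subseteq> P \<and> \<epsilon> > 0 \<and> {g \<in> V. \<forall>p\<in>Q. p (g - f) < \<epsilon>} \<subseteq> \<Union>K"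
    proof
      fix f assume "f \<in> \<Union>K"
      then obtain S where S: "S \<in> K" "f \<in> S" by blast
      from K S(1) have "?O S" by (rule bspec)
      with S(2) obtain Q \<epsilon> where Q: "finite Q" "Q \<subseteq> P" "\<epsilon> > 0"
          and sub: "{g \<in> V. \<forall>p\<in>Q. p (g - f) < \<epsilon>} \<subseteq> S"
        by blast
      have "{g \<in> V. \<forall>p\<in>Q. p (g - f) < \<epsilon>} \<subseteq> \<Union>K"
        using sub Union_upper[OF S(1)] by (rule order_trans)
      with Q show "\<exists>Q \<epsilon>. finite Q \<and> Q \<subseteq> P \<and> \<epsilon> > 0 \<and> {g \<in> V. \<forall>p\<in>Q. p (g - f) < \<epsilon>} \<subseteq> \<Union>K"
        by (intro exI conjI)
    qed
  qed
  then show ?thesis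
    by (simp add: seminorm_topology_def topology_inverse')
qed

lemma topspace_seminorm_topology [simp]: "topspace (seminorm_topology V P) = V"
proof -
  have "openin (seminorm_topology V P) V"
    unfolding openin_seminorm_topology
    by (auto intro!: exI[of _ "{}"] exI[of _ "1::real"])
  then show ?thesis
    using openin_subset openin_topspace by (metis openin_seminorm_topology subset_antisym)
qed

definition cnorm_on :: "('a \<Rightarrow> complex) set \<Rightarrow> (('a \<Rightarrow> complex) \<Rightarrow> real) \<Rightarrow> bool"
  where "cnorm_on V \<nu> \<longleftrightarrow> cfun.subspace V \<and>
    (\<forall>u\<in>V. 0 \<le> \<nu> u \<and> (\<nu> u = 0 \<longleftrightarrow> u = 0)) \<and>
    (\<forall>c. \<forall>u\<in>V. \<nu> (cscale c u) = cmod c * \<nu> u) \<and>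
    (\<forall>u\<in>V. \<forall>v\<in>V. \<nu> (u + v) \<le> \<nu> u + \<nu> v)"

text \<open>The value off \<open>V\<close> is irrelevant; it makes the distance symmetric and nonnegative
  everywhere, as the locale \<open>Metric_space\<close> demands.\<close>

definition norm_dist :: "('a \<Rightarrow> complex) set \<Rightarrow> (('a \<Rightarrow> complex) \<Rightarrow> real)
    \<Rightarrow> ('a \<Rightarrow> complex) \<Rightarrow> ('a \<Rightarrow> complex) \<Rightarrow> real"
  where "norm_dist V \<nu> u v = (if u \<in> V \<and> v \<in> V then \<nu> (u - v) else 0)"

lemma Metric_space_norm_dist:
  assumes "cnorm_on V \<nu>"
  shows "Metric_space V (norm_dist V \<nu>)"
proof -
  have sub: "cfun.subspace V" and nonneg: "\<And>u. u \<in> V \<Longrightarrow> 0 \<le> \<nu> u"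
    and zero: "\<And>u. u \<in> V \<Longrightarrow> \<nu> u = 0 \<longleftrightarrow> u = 0"
    and scale: "\<And>c u. u \<in> V \<Longrightarrow> \<nu> (cscale c u) = cmod c * \<nu> u"
    and tri: "\<And>u v. u \<in> V \<Longrightarrow> v \<in> V \<Longrightarrow> \<nu> (u + v) \<le> \<nu> u + \<nu> v"
    using assms unfolding cnorm_on_def by blast+
  have diff: "u - v \<in> V" if "u \<in> V" "v \<in> V" for u v
    using sub that by (rule cfun.subspace_diff)
  have comm: "\<nu> (u - v) = \<nu> (v - u)" if "u \<in> V" "v \<in> V" for u v
  proof -
    have "cscale (-1) (v - u) = u - v" by (auto simp: fun_eq_iff)
    then show ?thesis using scale[OF diff[OF that(2,1)], of "-1"] by simp
  qed
  show ?thesis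
  proof
    show "norm_dist V \<nu> x z \<le> norm_dist V \<nu> x y + norm_dist V \<nu> y z"
      if "x \<in> V" "y \<in> V" "z \<in> V" for x y z
      using tri[OF diff[OF that(1,2)] diff[OF that(2,3)]] that by (simp add: norm_dist_def)
    show "0 \<le> norm_dist V \<nu> x y" for x y
      by (simp add: norm_dist_def nonneg diff)
    show "norm_dist V \<nu> x y = norm_dist V \<nu> y x" for x y
      using comm[of x y] by (simp add: norm_dist_def)
    show "norm_dist V \<nu> x y = 0 \<longleftrightarrow> x = y" if "x \<in> V" "y \<in> V" for x y
      using zero[OF diff[OF that]] that by (simp add: norm_dist_def)
  qed
qed

definition banach_on :: "('a \<Rightarrow> complex) set \<Rightarrow> (('a \<Rightarrow> complex) \<Rightarrow> real) \<Rightarrow> bool"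
  where "banach_on V \<nu> \<longleftrightarrow> cnorm_on V \<nu> \<and> Metric_space.mcomplete V (norm_dist V \<nu>)"

definition continuously_embedded ::
    "('a \<Rightarrow> complex) set \<Rightarrow> (('a \<Rightarrow> complex) \<Rightarrow> real) \<Rightarrow> ('a \<Rightarrow> complex) topology \<Rightarrow> bool"
  where "continuously_embedded V \<nu> X \<longleftrightarrow>
    V \<subseteq> topspace X \<and> continuous_map (Metric_space.mtopology V (norm_dist V \<nu>)) X (\<lambda>u. u)"

definition equivalent_norms_on ::
    "('a \<Rightarrow> complex) set \<Rightarrow> (('a \<Rightarrow> complex) \<Rightarrow> real) \<Rightarrow> (('a \<Rightarrow> complex) \<Rightarrow> real) \<Rightarrow> bool"
  where "equivalent_norms_on V \<nu> \<nu>' \<longleftrightarrow>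
    (\<exists>c>0. \<exists>C>0. \<forall>u\<in>V. c * \<nu> u \<le> \<nu>' u \<and> \<nu>' u \<le> C * \<nu> u)"


section \<open>Schwartz functions and tempered distributions\<close>

definition dir_deriv :: "'a::euclidean_space \<Rightarrow> ('a \<Rightarrow> complex) \<Rightarrow> 'a \<Rightarrow> complex"
  where "dir_deriv b f = (\<lambda>x. frechet_derivative f (at x) b)"

text \<open>Lists of basis vectors play the role of multi-indices.\<close>

definition iter_deriv :: "'a::euclidean_space list \<Rightarrow> ('a \<Rightarrow> complex) \<Rightarrow> 'a \<Rightarrow> complex"
  where "iter_deriv bs f = foldr dir_deriv bs f"

definition smooth_fun :: "('a::euclidean_space \<Rightarrow> complex) \<Rightarrow> bool"
  where "smooth_fun f \<longleftrightarrow> (\<forall>bs\<in>lists Basis. \<forall>x. iter_deriv bs f differentiable (at x))"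

definition schwartz :: "('a::euclidean_space \<Rightarrow> complex) set"
  where "schwartz = {f. smooth_fun f \<and>
    (\<forall>k. \<forall>bs\<in>lists Basis. bounded (range (\<lambda>x. (1 + norm x) ^ k * cmod (iter_deriv bs f x))))}"

definition schwartz_seminorm :: "nat \<Rightarrow> 'a::euclidean_space list \<Rightarrow> ('a \<Rightarrow> complex) \<Rightarrow> real"
  where "schwartz_seminorm k bs f = (SUP x. (1 + norm x) ^ k * cmod (iter_deriv bs f x))"

definition schwartz_topology :: "('a::euclidean_space \<Rightarrow> complex) topology"
  where "schwartz_topology =
    seminorm_topology schwartz {schwartz_seminorm k bs |k bs. bs \<in> lists Basis}"

definition schwartz_bounded :: "('a::euclidean_space \<Rightarrow> complex) set \<Rightarrow> bool"
  where "schwartz_bounded B \<longleftrightarrow> B \<subseteq> schwartz \<and>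
    (\<forall>k. \<forall>bs\<in>lists Basis. bdd_above (schwartz_seminorm k bs ` B))"

text \<open>A tempered distribution is a functional on \<open>schwartz\<close>. Since HOL functions are
  total, it is extended by \<open>0\<close> to all other functions, so that equality of functionals is
  equality of distributions. The duality bracket is application.\<close>

definition tempered :: "(('a::euclidean_space \<Rightarrow> complex) \<Rightarrow> complex) set"
  where "tempered = {u.
    (\<forall>f\<in>schwartz. \<forall>g\<in>schwartz. u (f + g) = u f + u g) \<and>
    (\<forall>c. \<forall>f\<in>schwartz. u (cscale c f) = c * u f) \<and>
    continuous_map schwartz_topology euclidean u \<and>
    (\<forall>f. f \<notin> schwartz \<longrightarrow> u f = 0)}"

text \<open>The strong dual topology: uniform convergence on bounded sets.\<close>

definition tempered_topology :: "(('a::euclidean_space \<Rightarrow> complex) \<Rightarrow> complex) topology"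
  where "tempered_topology = seminorm_topology tempered
    {(\<lambda>u. SUP f\<in>B. cmod (u f)) |B. schwartz_bounded B \<and> B \<noteq> {}}"

definition tempered_iso :: "((('a::euclidean_space \<Rightarrow> complex) \<Rightarrow> complex) \<Rightarrow>
    (('a \<Rightarrow> complex) \<Rightarrow> complex)) \<Rightarrow> bool"
  where "tempered_iso T \<longleftrightarrow>
    clinear_on tempered T \<and> homeomorphic_map tempered_topology tempered_topology T"

definition regular_dist :: "'a::euclidean_space measure \<Rightarrow> ('a \<Rightarrow> complex) \<Rightarrow>
    (('a \<Rightarrow> complex) \<Rightarrow> complex)"
  where "regular_dist \<mu> F = (\<lambda>\<phi>. if \<phi> \<in> schwartz then (LINT x|\<mu>. F x * \<phi> x) else 0)"


section \<open>Phase space\<close>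

type_synonym 'n phase = "(real ^ 'n) \<times> (real ^ 'n)"
type_synonym 'n phase_fun = "'n phase \<Rightarrow> complex"
type_synonym 'n phase_dist = "'n phase_fun \<Rightarrow> complex"
type_synonym 'n phase2_fun = "'n phase \<times> 'n phase \<Rightarrow> complex"
type_synonym 'n phase2_dist = "'n phase2_fun \<Rightarrow> complex"

definition sympl :: "'n::finite phase \<Rightarrow> 'n phase \<Rightarrow> real"
  where "sympl X Y = fst Y \<bullet> snd X - fst X \<bullet> snd Y"

definition dXi :: "'n::finite phase measure"
  where "dXi = scale_measure (ennreal (1 / (2 * pi) ^ CARD('n))) lborel"

definition dXi2 :: "('n::finite phase \<times> 'n phase) measure"
  where "dXi2 = dXi \<Otimes>\<^sub>M dXi"

definition sympl_fourier :: "'n::finite phase_fun \<Rightarrow> 'n phase_fun"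
  where "sympl_fourier f = (\<lambda>Y. LINT Z|dXi. exp (- \<i> * of_real (sympl Y Z)) * f Z)"

definition char_fun :: "'n::finite phase \<Rightarrow> 'n phase_fun"
  where "char_fun X = (\<lambda>Z. exp (\<i> * of_real (sympl X Z)))"

abbreviation char_dist :: "'n::finite phase \<Rightarrow> 'n phase_dist"
  where "char_dist X \<equiv> regular_dist dXi (char_fun X)"

definition tensor :: "'n::finite phase_fun \<Rightarrow> 'n phase_fun \<Rightarrow> 'n phase2_fun"
  where "tensor f g = (\<lambda>(X, Y). f X * g Y)"

text \<open>The distribution \<open>u \<otimes> h\<close>, determined by its values \<open>u f * (LINT Y|dXi. h Y * g Y)\<close> on \<open>tensor f g\<close>.\<close>

definition dist_tensor :: "'n::finite phase_dist \<Rightarrow> 'n phase_fun \<Rightarrow> 'n phase2_dist"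
  where "dist_tensor u h =
    (\<lambda>\<phi>. if \<phi> \<in> schwartz then u (\<lambda>X. LINT Y|dXi. \<phi> (X, Y) * h Y) else 0)"


section \<open>The composition law\<close>

definition hypothesis_A ::
    "('n::finite phase_fun \<Rightarrow> 'n phase_fun \<Rightarrow> 'n phase_fun) \<Rightarrow> bool"
  where "hypothesis_A sharp \<longleftrightarrow>
    (\<forall>f\<in>schwartz. \<forall>g\<in>schwartz. sharp f g \<in> schwartz) \<and>
    (\<forall>f\<in>schwartz. clinear_on schwartz (sharp f)) \<and>
    (\<forall>g\<in>schwartz. clinear_on schwartz (\<lambda>f. sharp f g)) \<and>
    (\<forall>f\<in>schwartz. \<forall>g\<in>schwartz. \<forall>h\<in>schwartz. sharp (sharp f g) h = sharp f (sharp g h)) \<and>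
    (\<forall>f\<in>schwartz. continuous_map schwartz_topology schwartz_topology (sharp f)) \<and>
    (\<forall>g\<in>schwartz. continuous_map schwartz_topology schwartz_topology (\<lambda>f. sharp f g)) \<and>
    (\<forall>f\<in>schwartz. \<forall>g\<in>schwartz. cnj \<circ> sharp f g = sharp (cnj \<circ> g) (cnj \<circ> f)) \<and>
    (\<forall>f\<in>schwartz. \<forall>g\<in>schwartz. (LINT X|dXi. sharp f g X) = (LINT X|dXi. f X * g X))"

text \<open>\<open>u # g\<close> and \<open>g # u\<close> for a distribution \<open>u\<close>, by transposition: hypothesis A gives
  \<open>\<integral> (f # g) h = \<integral> f (g # h)\<close>.\<close>

definition dist_sharp :: "('n::finite phase_fun \<Rightarrow> 'n phase_fun \<Rightarrow> 'n phase_fun) \<Rightarrow>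
    'n phase_dist \<Rightarrow> 'n phase_fun \<Rightarrow> 'n phase_dist"
  where "dist_sharp sharp u g = (\<lambda>h. if h \<in> schwartz then u (sharp g h) else 0)"

definition sharp_dist :: "('n::finite phase_fun \<Rightarrow> 'n phase_fun \<Rightarrow> 'n phase_fun) \<Rightarrow>
    'n phase_fun \<Rightarrow> 'n phase_dist \<Rightarrow> 'n phase_dist"
  where "sharp_dist sharp g u = (\<lambda>h. if h \<in> schwartz then u (sharp h g) else 0)"

text \<open>Under hypothesis A one has \<open>(f\<^sub>1 # u) # f\<^sub>2 = f\<^sub>1 # (u # f\<^sub>2)\<close>, so the bracketing is
  immaterial.\<close>

definition sharp_dist_sharp :: "('n::finite phase_fun \<Rightarrow> 'n phase_fun \<Rightarrow> 'n phase_fun) \<Rightarrow>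
    'n phase_fun \<Rightarrow> 'n phase_dist \<Rightarrow> 'n phase_fun \<Rightarrow> 'n phase_dist"
  where "sharp_dist_sharp sharp f1 u f2 = dist_sharp sharp (sharp_dist sharp f1 u) f2"

definition hypothesis_B ::
    "('n::finite phase_fun \<Rightarrow> 'n phase_fun \<Rightarrow> 'n phase_fun) \<Rightarrow> bool"
  where "hypothesis_B sharp \<longleftrightarrow> (\<forall>f1\<in>schwartz. \<forall>f2\<in>schwartz. \<forall>u\<in>tempered.
    sharp_dist_sharp sharp f1 u f2 \<in> regular_dist dXi ` schwartz)"

definition dist_to_schwartz :: "'n::finite phase_dist \<Rightarrow> 'n phase_fun"
  where "dist_to_schwartz u = (THE f. f \<in> schwartz \<and> regular_dist dXi f = u)"

text \<open>The product \<open>u # f # v\<close> of two distributions with a Schwartz function in between,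
  meaningful under hypothesis B.\<close>

definition dist_sharp_dist :: "('n::finite phase_fun \<Rightarrow> 'n phase_fun \<Rightarrow> 'n phase_fun) \<Rightarrow>
    'n phase_dist \<Rightarrow> 'n phase_fun \<Rightarrow> 'n phase_dist \<Rightarrow> 'n phase_dist"
  where "dist_sharp_dist sharp u f v = (\<lambda>h. if h \<in> schwartz
    then u (dist_to_schwartz (sharp_dist_sharp sharp f v h)) else 0)"

definition Theta :: "('n::finite phase_fun \<Rightarrow> 'n phase_fun \<Rightarrow> 'n phase_fun) \<Rightarrow>
    'n phase \<Rightarrow> 'n phase_fun \<Rightarrow> 'n phase_dist"
  where "Theta sharp Z f = dist_sharp_dist sharp (char_dist (- Z)) f (char_dist Z)"

definition hypothesis_C ::
    "('n::finite phase_fun \<Rightarrow> 'n phase_fun \<Rightarrow> 'n phase_fun) \<Rightarrow> bool"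
  where "hypothesis_C sharp \<longleftrightarrow> (\<forall>f\<in>schwartz. \<forall>g\<in>schwartz.
    has_bochner_integral dXi (\<lambda>Z. Theta sharp Z f g) ((LINT Z|dXi. f Z) * (LINT Y|dXi. g Y)))"


section \<open>The modulation mapping and induced spaces\<close>

definition is_N_map :: "('n::finite phase_fun \<Rightarrow> 'n phase_fun \<Rightarrow> 'n phase_fun) \<Rightarrow>
    ('n phase2_fun \<Rightarrow> 'n phase2_dist) \<Rightarrow> bool"
  where "is_N_map sharp N \<longleftrightarrow>
    clinear_on schwartz N \<and> continuous_map schwartz_topology tempered_topology N \<and>
    (\<forall>f1\<in>schwartz. \<forall>f2\<in>schwartz. \<forall>g1\<in>schwartz. \<forall>g2\<in>schwartz.
      N (tensor f1 f2) (tensor g1 g2) =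
        (LINT X|dXi. sharp (sympl_fourier g1) f1 X * sharp (sympl_fourier g2) f2 X))"

definition C_map :: "'n::finite phase \<times> 'n phase \<Rightarrow> 'n phase \<times> 'n phase"
  where "C_map = (\<lambda>(X, Y). (- X, X - Y))"

lemma inv_C_map: "inv C_map = (\<lambda>(X, Y). (- X, - X - Y))"
proof (rule inv_unique_comp)
  show "C_map \<circ> (\<lambda>(X, Y). (- X, - X - Y)) = id"
    by (auto simp: C_map_def fun_eq_iff)
  show "(\<lambda>(X, Y). (- X, - X - Y)) \<circ> C_map = id"
    by (auto simp: C_map_def fun_eq_iff)
qed

text \<open>Composition \<open>F \<circ> C\<close> for a distribution \<open>F\<close>: by transposition, since the linear map \<open>C\<close> has
  determinant of modulus 1.\<close>

definition C_dist :: "'n::finite phase2_dist \<Rightarrow> 'n phase2_dist"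
  where "C_dist u = (\<lambda>\<phi>. if \<phi> \<in> schwartz then u (\<phi> \<circ> inv C_map) else 0)"

text \<open>\<open>M\<close> is the modulation mapping in its extended form: the topological isomorphism of
  the tempered distributions on \<open>\<Xi> \<times> \<Xi>\<close> which extends \<open>C \<circ> N\<close>. Both \<open>N\<close> and, by density of the
  Schwartz functions, \<open>M\<close> are determined by these properties (on their respective domains), so
  the modulation mapping is given by its characterisation.\<close>

definition is_modulation_map :: "('n::finite phase_fun \<Rightarrow> 'n phase_fun \<Rightarrow> 'n phase_fun) \<Rightarrow>
    ('n phase2_dist \<Rightarrow> 'n phase2_dist) \<Rightarrow> bool"
  where "is_modulation_map sharp M \<longleftrightarrow> tempered_iso M \<and>
    (\<exists>N. is_N_map sharp N \<and> (\<forall>F\<in>schwartz. M (regular_dist dXi2 F) = C_dist (N F)))"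

definition induced_space :: "('n::finite phase2_dist) set \<Rightarrow>
    ('n phase2_dist \<Rightarrow> 'n phase2_dist) \<Rightarrow> 'n phase_fun \<Rightarrow> 'n phase_dist set"
  where "induced_space L T h = {f \<in> tempered. T (dist_tensor f h) \<in> L}"

definition induced_norm :: "('n::finite phase2_dist \<Rightarrow> real) \<Rightarrow>
    ('n phase2_dist \<Rightarrow> 'n phase2_dist) \<Rightarrow> 'n phase_fun \<Rightarrow> 'n phase_dist \<Rightarrow> real"
  where "induced_norm \<nu> T h f = \<nu> (T (dist_tensor f h))"

end

theory Submission
  imports Defs "HOL-Probability.Sinc_Integral"
begin

text \<open>Write \<open>J f = T (f \<otimes> h)\<close> for \<open>T = M\<close> or \<open>T = MM\<close>. Pairing \<open>f \<otimes> h\<close> with \<open>\<phi> \<otimes> cnj h\<close> gives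
  \<open>\<parallel>h\<parallel>\<^sup>2\<close> times the pairing of \<open>f\<close> with \<open>\<phi>\<close>. Hence \<open>f\<close> depends continuously on \<open>J f\<close>, a limit of
  distributions \<open>f\<^sub>n \<otimes> h\<close> is again of the form \<open>f \<otimes> h\<close>, and the induced spaces are complete.
  The bijection \<open>M \<circ> MM\<^sup>-\<^sup>1\<close> of \<open>L\<close> makes both induced spaces equal as sets. Convergence in either
  norm implies pointwise convergence on Schwartz functions, so the two limits of a sequence that
  converges in both norms agree, and the closed graph theorem makes the norms equivalent.\<close>

section \<open>Schwartz functions\<close>

text \<open>The map \<open>M \<circ> inv_into tempered MM\<close> is only assumed to be a bijection
  of \<open>L\<close>, with no bound in the norm of \<open>L\<close>. Comparability of the norms
  therefore cannot be read off and has to be extracted from completeness. Two operators on Schwartz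
  functions carry the analysis: integration of \<open>F (X, Y)\<close> against \<open>h Y\<close>,
  whose transpose is \<open>u \<mapsto> u \<otimes> h\<close>, and
  \<open>f \<mapsto> f \<otimes> cnj h\<close>, whose transpose recovers a multiple of
  \<open>u\<close> from \<open>u \<otimes> h\<close>. Each must map Schwartz functions to Schwartz
  functions with seminorm bounds. The bounds for the first make \<open>u \<otimes> h\<close>
  tempered; those for the second make the candidate limit tempered by construction, so that its
  continuity need not be derived from a pointwise limit. The conjugate in the test function turns
  the factor into the integral of the squared modulus of \<open>h\<close>, which cannot vanish for a
  nonzero \<open>h\<close>.\<close>

lemma dir_deriv_eqI: "(f has_derivative f') (at x) \<Longrightarrow> dir_deriv b f x = f' b"
  by (simp add: dir_deriv_def frechet_derivative_at[symmetric])

lemma iter_deriv_Nil [simp]: "iter_deriv [] f = f"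
  by (simp add: iter_deriv_def)

lemma iter_deriv_Cons [simp]: "iter_deriv (b # bs) f = dir_deriv b (iter_deriv bs f)"
  by (simp add: iter_deriv_def)

lemma iter_deriv_append: "iter_deriv (bs @ cs) f = iter_deriv bs (iter_deriv cs f)"
  by (simp add: iter_deriv_def)

text \<open>A \<open>SUP\<close> of reals bounds its terms only when they are bounded above;
  membership in \<open>schwartz\<close> supplies this for every weight and derivative.\<close>

lemma schwartz_bound:
  assumes "f \<in> schwartz" "bs \<in> lists Basis"
  shows "(1 + norm x) ^ k * cmod (iter_deriv bs f x) \<le> schwartz_seminorm k bs f"
proof -
  have "bdd_above (range (\<lambda>x. (1 + norm x) ^ k * cmod (iter_deriv bs f x)))"
    using assms by (intro bounded_imp_bdd_above) (simp add: schwartz_def)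
  then show ?thesis
    unfolding schwartz_seminorm_def by (rule cSUP_upper[OF UNIV_I])
qed

lemma schwartz_bound0:
  assumes "f \<in> schwartz"
  shows "(1 + norm x) ^ k * cmod (f x) \<le> schwartz_seminorm k [] f"
  using schwartz_bound[OF assms, of "[]"] by simp

lemma schwartz_seminorm_nonneg:
  assumes "f \<in> schwartz" "bs \<in> lists Basis"
  shows "0 \<le> schwartz_seminorm k bs f"
proof -
  have "0 \<le> (1 + norm (0::'a)) ^ k * cmod (iter_deriv bs f 0)" by simp
  also have "\<dots> \<le> schwartz_seminorm k bs f" using assms by (rule schwartz_bound)
  finally show ?thesis .
qed

lemma schwartzI:
  assumes "\<And>bs x. bs \<in> lists Basis \<Longrightarrow> iter_deriv bs f differentiable (at x)"
    and "\<And>k bs. bs \<in> lists Basis \<Longrightarrow> \<exists>C. \<forall>x. (1 + norm x) ^ k * cmod (iter_deriv bs f x) \<le> C"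
  shows "f \<in> schwartz"
  unfolding schwartz_def smooth_fun_def
proof (intro CollectI conjI ballI allI)
  show "iter_deriv bs f differentiable (at x)" if "bs \<in> lists Basis" for bs x
    using assms(1) that .
  show "bounded (range (\<lambda>x. (1 + norm x) ^ k * cmod (iter_deriv bs f x)))"
    if bs: "bs \<in> lists Basis" for k bs
  proof -
    obtain C where C: "\<And>x. (1 + norm x) ^ k * cmod (iter_deriv bs f x) \<le> C"
      using assms(2)[OF bs] by blast
    show ?thesis
      by (rule boundedI[of _ C]) (use C in auto)
  qed
qed

lemma schwartz_differentiable: "f \<in> schwartz \<Longrightarrow> f differentiable (at x)"
  unfolding schwartz_def smooth_fun_def by (auto dest: bspec[of _ _ "[]"])

lemma schwartz_iter_deriv:
  assumes "f \<in> schwartz" "bs \<in> lists Basis"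
  shows "iter_deriv bs f \<in> schwartz"
proof (rule schwartzI)
  fix cs :: "'a list" assume "cs \<in> lists Basis"
  then have cs: "cs @ bs \<in> lists Basis" using assms(2) by simp
  show "iter_deriv cs (iter_deriv bs f) differentiable (at x)" for x
    using assms(1) cs unfolding schwartz_def smooth_fun_def iter_deriv_append[symmetric] by blast
  show "\<exists>C. \<forall>x. (1 + norm x) ^ k * cmod (iter_deriv cs (iter_deriv bs f) x) \<le> C" for k
    using schwartz_bound[OF assms(1) cs] unfolding iter_deriv_append[symmetric] by blast
qed

lemma schwartz_dir_deriv: "f \<in> schwartz \<Longrightarrow> b \<in> Basis \<Longrightarrow> dir_deriv b f \<in> schwartz"
  using schwartz_iter_deriv[of f "[b]"] by simp

text \<open>In coordinates the coefficients of the derivative are again Schwartz functions, so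
  seminorms control it uniformly in \<open>x\<close>. The Lipschitz and Taylor estimates rest on
  this form.\<close>

lemma schwartz_has_derivative:
  assumes "f \<in> schwartz"
  shows "(f has_derivative (\<lambda>v. \<Sum>b\<in>Basis. (v \<bullet> b) *\<^sub>R dir_deriv b f x)) (at x)"
proof -
  let ?D = "frechet_derivative f (at x)"
  have D: "(f has_derivative ?D) (at x)"
    using schwartz_differentiable[OF assms] by (simp add: frechet_derivative_works)
  then have lin: "linear ?D" by (rule has_derivative_linear)
  have "?D v = (\<Sum>b\<in>Basis. (v \<bullet> b) *\<^sub>R dir_deriv b f x)" for v
  proof -
    have "?D v = ?D (\<Sum>b\<in>Basis. (v \<bullet> b) *\<^sub>R b)" by (simp add: euclidean_representation)
    also have "\<dots> = (\<Sum>b\<in>Basis. (v \<bullet> b) *\<^sub>R ?D b)"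
      using lin by (simp add: linear_sum linear_scale)
    finally show ?thesis by (simp add: dir_deriv_def)
  qed
  then have "?D = (\<lambda>v. \<Sum>b\<in>Basis. (v \<bullet> b) *\<^sub>R dir_deriv b f x)" by auto
  with D show ?thesis by simp
qed

lemma schwartz_continuous: "f \<in> schwartz \<Longrightarrow> continuous_on UNIV f"
  by (simp add: continuous_at_imp_continuous_on differentiable_imp_continuous_within
      schwartz_differentiable)

lemma schwartz_borel_measurable: "f \<in> schwartz \<Longrightarrow> f \<in> borel_measurable borel"
  by (simp add: schwartz_continuous borel_measurable_continuous_onI)

lemma schwartz_cmod_le: "f \<in> schwartz \<Longrightarrow> cmod (f x) \<le> schwartz_seminorm 0 [] f"
  using schwartz_bound0[of f x 0] by simp

text \<open>Membership in \<open>schwartz\<close> guarantees differentiability at each stage;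
  \<open>frechet_derivative\<close> is an unspecified choice where a function has no
  derivative.\<close>

lemma iter_deriv_add:
  assumes "f \<in> schwartz" "g \<in> schwartz" "bs \<in> lists Basis"
  shows "iter_deriv bs (f + g) = iter_deriv bs f + iter_deriv bs g"
  using assms(3)
proof (induction bs)
  case (Cons b bs)
  then have bs: "bs \<in> lists Basis" by simp
  let ?f = "iter_deriv bs f" and ?g = "iter_deriv bs g"
  have fg: "?f \<in> schwartz" "?g \<in> schwartz" using assms bs by (auto intro: schwartz_iter_deriv)
  have "dir_deriv b (?f + ?g) x = (dir_deriv b ?f + dir_deriv b ?g) x" for x
  proof -
    have "(?f + ?g has_derivative
        (\<lambda>v. frechet_derivative ?f (at x) v + frechet_derivative ?g (at x) v)) (at x)"
      unfolding plus_fun_def using fg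
      by (intro has_derivative_add) (simp_all add: schwartz_differentiable flip: frechet_derivative_works)
    from dir_deriv_eqI[OF this] show ?thesis by (simp add: dir_deriv_def)
  qed
  then have "dir_deriv b (?f + ?g) = dir_deriv b ?f + dir_deriv b ?g" by (rule ext)
  with Cons.IH show ?case unfolding iter_deriv_Cons by metis
qed simp

lemma schwartz_add:
  assumes "f \<in> schwartz" "g \<in> schwartz"
  shows "f + g \<in> schwartz"
proof (rule schwartzI)
  fix bs :: "'a list" assume bs: "bs \<in> lists Basis"
  have fg: "iter_deriv bs f \<in> schwartz" "iter_deriv bs g \<in> schwartz"
    using assms bs by (auto intro: schwartz_iter_deriv)
  then have "iter_deriv bs f + iter_deriv bs g differentiable (at x)" for x
    unfolding plus_fun_def by (intro differentiable_add schwartz_differentiable)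
  then show "iter_deriv bs (f + g) differentiable (at x)" for x
    by (simp only: iter_deriv_add[OF assms bs])
  show "\<exists>C. \<forall>x. (1 + norm x) ^ k * cmod (iter_deriv bs (f + g) x) \<le> C" for k
  proof (intro exI allI)
    fix x
    have "(1 + norm x) ^ k * cmod (iter_deriv bs (f + g) x)
        \<le> (1 + norm x) ^ k * (cmod (iter_deriv bs f x) + cmod (iter_deriv bs g x))"
      unfolding iter_deriv_add[OF assms bs] plus_fun_apply
      by (rule mult_left_mono) (auto intro: norm_triangle_ineq)
    also have "\<dots> \<le> schwartz_seminorm k bs f + schwartz_seminorm k bs g"
      unfolding distrib_left using assms bs by (intro add_mono schwartz_bound)
    finally show "(1 + norm x) ^ k * cmod (iter_deriv bs (f + g) x)
        \<le> schwartz_seminorm k bs f + schwartz_seminorm k bs g" .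
  qed
qed

text \<open>A family of operators that is stable under commutation with derivatives acts on Schwartz
  functions as soon as it satisfies the estimates of order zero.\<close>

lemma schwartz_operator_family:
  fixes \<A> :: "(('a::euclidean_space \<Rightarrow> complex) \<Rightarrow> ('b::euclidean_space \<Rightarrow> complex)) set"
  assumes diff: "\<And>A. A \<in> \<A> \<Longrightarrow> \<forall>f\<in>schwartz. \<forall>x. A f differentiable (at x)"
    and comm: "\<And>A b. A \<in> \<A> \<Longrightarrow> b \<in> Basis \<Longrightarrow>
      \<exists>A'\<in>\<A>. \<exists>cs\<in>lists Basis. \<forall>f\<in>schwartz. dir_deriv b (A f) = A' (iter_deriv cs f)"
    and bound: "\<And>A k. A \<in> \<A> \<Longrightarrow>
      \<exists>C\<ge>0. \<forall>f\<in>schwartz. \<forall>x. (1 + norm x) ^ k * cmod (A f x) \<le> C * schwartz_seminorm k [] f"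
    and A: "A \<in> \<A>"
  shows "\<forall>f\<in>schwartz. A f \<in> schwartz"
    and "\<forall>k. \<forall>bs\<in>lists Basis. \<exists>cs\<in>lists Basis. \<exists>C\<ge>0. \<forall>f\<in>schwartz.
      schwartz_seminorm k bs (A f) \<le> C * schwartz_seminorm k cs f"
proof -
  \<comment> \<open>One pair \<open>A'\<close>, \<open>cs\<close> serves all \<open>f\<close> at
    once. This order of quantifiers is what makes the resulting seminorm bound uniform in
    \<open>f\<close>.\<close>
  have iter: "\<exists>A'\<in>\<A>. \<exists>cs\<in>lists Basis. \<forall>f\<in>schwartz. iter_deriv bs (A f) = A' (iter_deriv cs f)"
    if "bs \<in> lists Basis" for bs
    using that
  proof (induction bs)
    case Nil
    show ?case using A by (auto intro!: bexI[of _ A] bexI[of _ "[]"])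
  next
    case (Cons b bs)
    then obtain A1 cs where A1: "A1 \<in> \<A>" "cs \<in> lists Basis"
      "\<forall>f\<in>schwartz. iter_deriv bs (A f) = A1 (iter_deriv cs f)" by auto
    obtain A2 ds where A2: "A2 \<in> \<A>" "ds \<in> lists Basis"
      "\<forall>f\<in>schwartz. dir_deriv b (A1 f) = A2 (iter_deriv ds f)"
      using comm[OF A1(1)] Cons.hyps by metis
    have "\<forall>f\<in>schwartz. iter_deriv (b # bs) (A f) = A2 (iter_deriv (ds @ cs) f)"
      using A1 A2 by (simp add: iter_deriv_append schwartz_iter_deriv)
    with A1(2) A2(1,2) show ?case
      by (intro bexI[of _ A2] bexI[of _ "ds @ cs"]) auto
  qed
  have est: "\<exists>cs\<in>lists Basis. \<exists>C\<ge>0. \<forall>f\<in>schwartz. \<forall>x.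
      (1 + norm x) ^ k * cmod (iter_deriv bs (A f) x) \<le> C * schwartz_seminorm k cs f"
    if bs: "bs \<in> lists Basis" for k bs
  proof -
    obtain A' cs where A': "A' \<in> \<A>" "cs \<in> lists Basis"
      "\<forall>f\<in>schwartz. iter_deriv bs (A f) = A' (iter_deriv cs f)" using iter[OF bs] by blast
    obtain C where C: "C \<ge> 0"
      "\<forall>f\<in>schwartz. \<forall>x. (1 + norm x) ^ k * cmod (A' f x) \<le> C * schwartz_seminorm k [] f"
      using bound[OF A'(1)] by blast
    have "\<forall>f\<in>schwartz. \<forall>x.
        (1 + norm x) ^ k * cmod (iter_deriv bs (A f) x) \<le> C * schwartz_seminorm k cs f"
    proof (intro ballI allI)
      fix f :: "'a \<Rightarrow> complex" and x assume f: "f \<in> schwartz"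
      \<comment> \<open>The order-zero bound is applied to the derivative of \<open>f\<close>, and
        its seminorm without derivatives is the seminorm of \<open>f\<close> with multi-index
        \<open>cs\<close>.\<close>
      have "schwartz_seminorm k [] (iter_deriv cs f) = schwartz_seminorm k cs f"
        by (simp add: schwartz_seminorm_def)
      then show "(1 + norm x) ^ k * cmod (iter_deriv bs (A f) x) \<le> C * schwartz_seminorm k cs f"
        using C(2) schwartz_iter_deriv[OF f A'(2)] A'(3) f by metis
    qed
    with A'(2) C(1) show ?thesis by blast
  qed
  show "\<forall>f\<in>schwartz. A f \<in> schwartz"
  proof
    fix f :: "'a \<Rightarrow> complex" assume f: "f \<in> schwartz"
    show "A f \<in> schwartz"
    proof (rule schwartzI)
      fix bs :: "'b list" assume bs: "bs \<in> lists Basis"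
      show "iter_deriv bs (A f) differentiable (at x)" for x
        using iter[OF bs] diff f schwartz_iter_deriv by metis
      show "\<exists>C. \<forall>x. (1 + norm x) ^ k * cmod (iter_deriv bs (A f) x) \<le> C" for k
        using est[OF bs] f by blast
    qed
  qed
  show "\<forall>k. \<forall>bs\<in>lists Basis. \<exists>cs\<in>lists Basis. \<exists>C\<ge>0. \<forall>f\<in>schwartz.
      schwartz_seminorm k bs (A f) \<le> C * schwartz_seminorm k cs f"
  proof (intro allI ballI)
    fix k and bs :: "'b list" assume bs: "bs \<in> lists Basis"
    obtain cs C where cs: "cs \<in> lists Basis" "C \<ge> 0" and le: "\<forall>f\<in>schwartz. \<forall>x.
      (1 + norm x) ^ k * cmod (iter_deriv bs (A f) x) \<le> C * schwartz_seminorm k cs f"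
      using est[OF bs] by blast
    have "\<forall>f\<in>schwartz. schwartz_seminorm k bs (A f) \<le> C * schwartz_seminorm k cs f"
      unfolding schwartz_seminorm_def[of k bs] by (intro ballI cSUP_least) (use le in auto)
    with cs show "\<exists>cs\<in>lists Basis. \<exists>C\<ge>0. \<forall>f\<in>schwartz.
      schwartz_seminorm k bs (A f) \<le> C * schwartz_seminorm k cs f" by blast
  qed
qed

text \<open>\<open>T\<close> commutes with differentiation, so a family with one member is stable.
  Linearity is over the reals, which covers both multiplication by a complex constant and
  conjugation.\<close>

lemma schwartz_bounded_linear:
  fixes f :: "'a::euclidean_space \<Rightarrow> complex"
  assumes T: "bounded_linear T" and f: "f \<in> schwartz"
  shows "T \<circ> f \<in> schwartz"
proof -
  interpret T: bounded_linear T by fact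
  have D: "(T \<circ> g has_derivative (\<lambda>v. T (frechet_derivative g (at x) v))) (at x)"
    if "g \<in> schwartz" for g :: "'a \<Rightarrow> complex" and x
    unfolding o_def using that
    by (intro T.has_derivative) (simp add: schwartz_differentiable flip: frechet_derivative_works)
  have comm: "\<forall>f\<in>schwartz. dir_deriv b (T \<circ> f) = T \<circ> dir_deriv b f" for b :: 'a
    using dir_deriv_eqI[OF D] by (auto simp: fun_eq_iff dir_deriv_def)
  have bound: "(1 + norm x) ^ k * cmod ((T \<circ> f) x) \<le> onorm T * schwartz_seminorm k [] f"
    if "f \<in> schwartz" for f :: "'a \<Rightarrow> complex" and x k
  proof -
    have "(1 + norm x) ^ k * cmod ((T \<circ> f) x) \<le> (1 + norm x) ^ k * (onorm T * cmod (f x))"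
      by (intro mult_left_mono) (simp_all add: onorm[OF T])
    also have "\<dots> = onorm T * ((1 + norm x) ^ k * cmod (f x))" by (simp add: ac_simps)
    also have "\<dots> \<le> onorm T * schwartz_seminorm k [] f"
      by (intro mult_left_mono schwartz_bound0 that onorm_pos_le[OF T])
    finally show ?thesis .
  qed
  have "\<forall>f::'a \<Rightarrow> complex\<in>schwartz. (\<circ>) T f \<in> schwartz"
  proof (rule schwartz_operator_family(1)[where \<A> = "{(\<circ>) T}"])
    fix A :: "('a \<Rightarrow> complex) \<Rightarrow> 'a \<Rightarrow> complex" assume "A \<in> {(\<circ>) T}"
    then have A: "A = (\<circ>) T" by simp
    show "\<forall>f\<in>schwartz. \<forall>x. A f differentiable (at x)"
      unfolding A using D differentiableI by blast
    show "\<exists>A'\<in>{(\<circ>) T}. \<exists>cs\<in>lists Basis. \<forall>f\<in>schwartz. dir_deriv b (A f) = A' (iter_deriv cs f)"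
      if "b \<in> Basis" for b :: 'a
      unfolding A using that comm by (intro bexI[of _ "(\<circ>) T"] bexI[of _ "[b]"]) auto
    show "\<exists>C\<ge>0. \<forall>f\<in>schwartz. \<forall>x. (1 + norm x) ^ k * cmod (A f x) \<le> C * schwartz_seminorm k [] f" for k
      unfolding A using bound onorm_pos_le[OF T] by blast
  qed simp
  with f show ?thesis by blast
qed

lemma schwartz_cscale: "f \<in> schwartz \<Longrightarrow> cscale c f \<in> schwartz"
  using schwartz_bounded_linear[OF bounded_linear_mult_right[of c]] by (simp add: o_def)

lemma schwartz_cnj: "f \<in> schwartz \<Longrightarrow> cnj \<circ> f \<in> schwartz"
  by (rule schwartz_bounded_linear[OF bounded_linear_cnj])

lemma schwartz_diff:
  assumes "f \<in> schwartz" "g \<in> schwartz"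
  shows "f - g \<in> schwartz"
proof -
  have "f - g = f + cscale (-1) g" by (auto simp: fun_eq_iff)
  then show ?thesis using schwartz_add[OF assms(1) schwartz_cscale[OF assms(2), of "-1"]] by metis
qed

section \<open>Continuous operators on Schwartz functions and tempered distributions\<close>

text \<open>Each target seminorm is dominated by a multiple of a single source seminorm, so a basic
  neighbourhood given by finitely many seminorms pulls back to one of the same kind.\<close>

lemma seminorm_topology_continuous_map:
  assumes maps: "\<And>f. f \<in> V \<Longrightarrow> A f \<in> W"
    and diff: "\<And>f g. f \<in> V \<Longrightarrow> g \<in> V \<Longrightarrow> A g - A f = A (g - f)"
    and V: "\<And>f g. f \<in> V \<Longrightarrow> g \<in> V \<Longrightarrow> g - f \<in> V"
    and bound: "\<And>q. q \<in> R \<Longrightarrow> \<exists>p\<in>P. \<exists>C\<ge>0. \<forall>f\<in>V. q (A f) \<le> C * p f"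
  shows "continuous_map (seminorm_topology V P) (seminorm_topology W R) A"
  unfolding continuous_map_def topspace_seminorm_topology
proof (intro conjI allI impI)
  show "A \<in> V \<rightarrow> W" using maps by blast
  fix U assume U: "openin (seminorm_topology W R) U"
  show "openin (seminorm_topology V P) {f \<in> V. A f \<in> U}"
    unfolding openin_seminorm_topology
  proof (intro conjI ballI)
    show "{f \<in> V. A f \<in> U} \<subseteq> V" by blast
    fix f assume "f \<in> {f \<in> V. A f \<in> U}"
    then have f: "f \<in> V" "A f \<in> U" by auto
    obtain Q \<epsilon> where Q: "finite Q" "Q \<subseteq> R" "\<epsilon> > 0" "{g \<in> W. \<forall>q\<in>Q. q (g - A f) < \<epsilon>} \<subseteq> U"
      using U f(2) unfolding openin_seminorm_topology by blast
    obtain p C where pC: "\<And>q. q \<in> R \<Longrightarrow> p q \<in> P \<and> C q \<ge> 0 \<and> (\<forall>f\<in>V. q (A f) \<le> C q * p q f)"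
      using bound by metis
    \<comment> \<open>The sum bounds every constant \<open>C q\<close> with \<open>q\<close> in
      \<open>Q\<close>, so one radius serves all of them; the summand 1 keeps the denominator
      positive and makes the final inequality strict.\<close>
    define \<delta> where "\<delta> = \<epsilon> / (1 + sum C Q)"
    have C0: "0 \<le> C q" "C q \<le> sum C Q" if "q \<in> Q" for q
      using that Q pC by (auto intro!: member_le_sum)
    have S0: "0 \<le> sum C Q" using C0(1) by (rule sum_nonneg)
    then have \<delta>: "\<delta> > 0" using Q(3) by (simp add: \<delta>_def)
    have "{g \<in> V. \<forall>p'\<in>p ` Q. p' (g - f) < \<delta>} \<subseteq> {f \<in> V. A f \<in> U}"
    proof clarify
      fix g assume g: "g \<in> V" "\<forall>p'\<in>p ` Q. p' (g - f) < \<delta>"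
      have "q (A g - A f) < \<epsilon>" if q: "q \<in> Q" for q
      proof -
        have "q (A g - A f) \<le> C q * p q (g - f)"
          using diff[OF f(1) g(1)] V[OF f(1) g(1)] pC Q(2) q by auto
        also have "\<dots> \<le> sum C Q * \<delta>"
        \<comment> \<open>The members of \<open>P\<close> are arbitrary real functions here, so a
          negative value has to be treated apart before the product can be estimated factor by
          factor.\<close>
        proof (cases "p q (g - f) \<le> 0")
          case True
          then have "C q * p q (g - f) \<le> 0" using C0(1)[OF q] by (rule mult_nonneg_nonpos[rotated])
          also have "0 \<le> sum C Q * \<delta>" using S0 \<delta> by simp
          finally show ?thesis .
        next
          case False
          then show ?thesis using g(2) q C0[OF q] by (intro mult_mono) (auto intro: less_imp_le)
        qed
        also have "\<dots> < (1 + sum C Q) * \<delta>" using \<delta> by (simp add: distrib_right)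
        also have "\<dots> = \<epsilon>" using S0 by (simp add: \<delta>_def)
        finally show ?thesis .
      qed
      then show "A g \<in> U" using Q(4) maps[OF g(1)] by blast
    qed
    then show "\<exists>Q \<epsilon>. finite Q \<and> Q \<subseteq> P \<and> \<epsilon> > 0 \<and> {g \<in> V. \<forall>p\<in>Q. p (g - f) < \<epsilon>} \<subseteq> {f \<in> V. A f \<in> U}"
      using Q(1,2) pC \<delta> by (intro exI[of _ "p ` Q"] exI[of _ \<delta>]) auto
  qed
qed

lemma tempered_add: "u \<in> tempered \<Longrightarrow> f \<in> schwartz \<Longrightarrow> g \<in> schwartz \<Longrightarrow> u (f + g) = u f + u g"
  and tempered_cscale: "u \<in> tempered \<Longrightarrow> f \<in> schwartz \<Longrightarrow> u (cscale c f) = c * u f"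
  and tempered_continuous: "u \<in> tempered \<Longrightarrow> continuous_map schwartz_topology euclidean u"
  and tempered_outside: "u \<in> tempered \<Longrightarrow> f \<notin> schwartz \<Longrightarrow> u f = 0"
  unfolding tempered_def by blast+

lemma topspace_schwartz_topology [simp]: "topspace schwartz_topology = schwartz"
  by (simp add: schwartz_topology_def)

lemma topspace_tempered_topology [simp]: "topspace tempered_topology = tempered"
  by (simp add: tempered_topology_def)

text \<open>Transposition of a continuous operator. It is used with the partial integral against
  \<open>h\<close>, giving \<open>dist_tensor\<close>, and with the tensor product by
  \<open>cnj \<circ> h\<close>, giving the limit in the completeness proof. The value 0 off
  \<open>schwartz\<close> is the normalisation built into \<open>tempered\<close>.\<close>

lemma tempered_comp:
  fixes A :: "('a::euclidean_space \<Rightarrow> complex) \<Rightarrow> ('b::euclidean_space \<Rightarrow> complex)"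
  assumes u: "u \<in> tempered"
    and maps: "\<forall>f\<in>schwartz. A f \<in> schwartz"
    and add: "\<And>f g. f \<in> schwartz \<Longrightarrow> g \<in> schwartz \<Longrightarrow> A (f + g) = A f + A g"
    and scale: "\<And>c f. f \<in> schwartz \<Longrightarrow> A (cscale c f) = cscale c (A f)"
    and bound: "\<forall>k. \<forall>bs\<in>lists Basis. \<exists>cs\<in>lists Basis. \<exists>C\<ge>0. \<forall>f\<in>schwartz.
      schwartz_seminorm k bs (A f) \<le> C * schwartz_seminorm k cs f"
  shows "(\<lambda>f. if f \<in> schwartz then u (A f) else 0) \<in> tempered"
proof -
  have minus: "A g - A f = A (g - f)" if "f \<in> schwartz" "g \<in> schwartz" for f g
  proof -
    have "g - f = g + cscale (-1) f" by (auto simp: fun_eq_iff)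
    then have "A (g - f) = A g + cscale (-1) (A f)"
      using add[OF that(2) schwartz_cscale[OF that(1), of "-1"]] scale[OF that(1), of "-1"] by metis
    then show ?thesis by (auto simp: fun_eq_iff)
  qed
  have "continuous_map schwartz_topology schwartz_topology A"
    unfolding schwartz_topology_def
  proof (rule seminorm_topology_continuous_map)
    fix q :: "('b \<Rightarrow> complex) \<Rightarrow> real"
    assume "q \<in> {schwartz_seminorm k bs |k bs. bs \<in> lists Basis}"
    then obtain k bs where q: "q = schwartz_seminorm k bs" "bs \<in> lists Basis" by blast
    then obtain cs C where "cs \<in> lists Basis" "C \<ge> 0"
      "\<forall>f\<in>schwartz. q (A f) \<le> C * schwartz_seminorm k cs f" using bound by blast
    then show "\<exists>p\<in>{schwartz_seminorm k bs |k bs. bs \<in> lists Basis}. \<exists>C\<ge>0. \<forall>f\<in>schwartz.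
        q (A f) \<le> C * p f" by blast
  qed (use maps minus schwartz_diff in blast)+
  from continuous_map_compose[OF this tempered_continuous[OF u]]
  have "continuous_map schwartz_topology euclidean (\<lambda>f. if f \<in> schwartz then u (A f) else 0)"
    by (rule continuous_map_eq) simp
  moreover have "(if f + g \<in> schwartz then u (A (f + g)) else 0)
      = (if f \<in> schwartz then u (A f) else 0) + (if g \<in> schwartz then u (A g) else 0)"
    if "f \<in> schwartz" "g \<in> schwartz" for f g
    unfolding if_P[OF that(1)] if_P[OF that(2)] if_P[OF schwartz_add[OF that]] add[OF that]
    using maps that by (intro tempered_add[OF u]) auto
  moreover have "(if cscale c f \<in> schwartz then u (A (cscale c f)) else 0)
      = c * (if f \<in> schwartz then u (A f) else 0)" if "f \<in> schwartz" for c f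
    unfolding if_P[OF that] if_P[OF schwartz_cscale[OF that]] scale[OF that]
    using maps that by (intro tempered_cscale[OF u]) auto
  ultimately show ?thesis unfolding tempered_def by auto
qed

lemma tempered_subspace: "cfun.subspace tempered"
  unfolding cfun.subspace_def
proof (intro conjI ballI allI)
  show "0 \<in> tempered" by (simp add: tempered_def zero_fun_def)
  fix u v :: "('a \<Rightarrow> complex) \<Rightarrow> complex" and c :: complex assume u: "u \<in> tempered"
  note U = tempered_add[OF u] tempered_cscale[OF u] tempered_outside[OF u]
  have "continuous_map schwartz_topology euclidean (\<lambda>f. c * u f)"
    by (rule continuous_map_compose[OF tempered_continuous[OF u], of _ "(*) c", unfolded o_def])
      (auto intro: continuous_intros)
  then show "cscale c u \<in> tempered"
    using U unfolding tempered_def by (auto simp: distrib_left)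
  assume v: "v \<in> tempered"
  note V = tempered_add[OF v] tempered_cscale[OF v] tempered_outside[OF v]
  have "continuous_map schwartz_topology euclidean (\<lambda>f. u f + v f)"
    using tempered_continuous[OF u] tempered_continuous[OF v] by (rule continuous_map_add)
  then show "u + v \<in> tempered"
    using U V unfolding tempered_def plus_fun_def by (auto simp: distrib_left)
qed

text \<open>A singleton is a bounded set, so \<open>cmod (u f)\<close> is itself one of the
  seminorms of the strong dual topology.\<close>

lemma tempered_topology_eval:
  assumes f: "f \<in> schwartz"
  shows "continuous_map tempered_topology euclidean (\<lambda>u. u f)"
  unfolding continuous_map_def topspace_tempered_topology
proof (intro conjI allI impI)
  fix U :: "complex set" assume "openin euclidean U"
  then have U: "open U" by simp
  show "openin tempered_topology {u \<in> tempered. u f \<in> U}"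
    unfolding tempered_topology_def openin_seminorm_topology
  proof (intro conjI ballI)
    fix u assume "u \<in> {u \<in> tempered. u f \<in> U}"
    then obtain \<epsilon> where \<epsilon>: "\<epsilon> > 0" "ball (u f) \<epsilon> \<subseteq> U" using U openE by blast
    have "schwartz_bounded {f}" using f by (simp add: schwartz_bounded_def)
    then have "(\<lambda>u. SUP f\<in>{f}. cmod (u f))
        \<in> {(\<lambda>u. SUP f\<in>B. cmod (u f)) |B. schwartz_bounded B \<and> B \<noteq> {}}" by blast
    moreover have "{v \<in> tempered. \<forall>p\<in>{\<lambda>u. SUP f\<in>{f}. cmod (u f)}. p (v - u) < \<epsilon>}
        \<subseteq> {u \<in> tempered. u f \<in> U}"
      using \<epsilon>(2) by (auto simp: subset_eq dist_norm norm_minus_commute)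
    ultimately show "\<exists>Q \<epsilon>. finite Q \<and> Q \<subseteq> {(\<lambda>u. SUP f\<in>B. cmod (u f)) |B. schwartz_bounded B \<and> B \<noteq> {}}
        \<and> \<epsilon> > 0 \<and> {g \<in> tempered. \<forall>p\<in>Q. p (g - u) < \<epsilon>} \<subseteq> {u \<in> tempered. u f \<in> U}"
      using \<epsilon>(1) by (intro exI[of _ "{\<lambda>u. SUP f\<in>{f}. cmod (u f)}"] exI[of _ \<epsilon>]) simp
  qed blast
qed simp

section \<open>Tensor products and partial integrals\<close>

text \<open>Every basis vector of the product has one zero component, and in such a direction only
  one term of the product rule survives.\<close>

lemma tensor_dir_deriv:
  fixes f g :: "'n::finite phase_fun"
  assumes f: "f \<in> schwartz" and g: "g \<in> schwartz"
  shows "tensor f g differentiable (at z)"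
    and "dir_deriv (b, 0) (tensor f g) = tensor (dir_deriv b f) g"
    and "dir_deriv (0, b) (tensor f g) = tensor f (dir_deriv b g)"
proof -
  let ?f = "\<lambda>x. frechet_derivative f (at x)" and ?g = "\<lambda>x. frechet_derivative g (at x)"
  have f': "(f has_derivative ?f x) (at x)" and g': "(g has_derivative ?g x) (at x)" for x
    using f g by (simp_all add: schwartz_differentiable flip: frechet_derivative_works)
  have tensor: "tensor f g = (\<lambda>z. f (fst z) * g (snd z))" for f g :: "'n phase_fun"
    by (auto simp: tensor_def)
  have D: "(tensor f g has_derivative
      (\<lambda>v. f (fst z) * ?g (snd z) (snd v) + ?f (fst z) (fst v) * g (snd z))) (at z)" for z
    unfolding tensor
    by (intro has_derivative_mult has_derivative_compose[OF has_derivative_fst[OF has_derivative_ident] f']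
        has_derivative_compose[OF has_derivative_snd[OF has_derivative_ident] g'])
  then show "tensor f g differentiable (at z)" by (rule differentiableI)
  have 0: "?f x 0 = 0" "?g x 0 = 0" for x
    using linear_0[OF has_derivative_linear[OF f']] linear_0[OF has_derivative_linear[OF g']] by auto
  show "dir_deriv (b, 0) (tensor f g) = tensor (dir_deriv b f) g"
    by (rule ext) (simp only: dir_deriv_eqI[OF D], simp add: tensor 0 dir_deriv_def)
  show "dir_deriv (0, b) (tensor f g) = tensor f (dir_deriv b g)"
    by (rule ext) (simp only: dir_deriv_eqI[OF D], simp add: tensor 0 dir_deriv_def)
qed

text \<open>A derivative in the second variable falls on \<open>g\<close> and not on
  \<open>f\<close>, so the operator for a fixed \<open>g\<close> is not stable under
  differentiation. The family over all Schwartz \<open>g\<close> is.\<close>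

lemma tensor_schwartz:
  fixes g :: "'n::finite phase_fun"
  assumes g: "g \<in> schwartz"
  shows "\<forall>f\<in>schwartz. tensor f g \<in> schwartz"
    and "\<forall>k. \<forall>bs\<in>lists Basis. \<exists>cs\<in>lists Basis. \<exists>C\<ge>0. \<forall>f\<in>schwartz.
      schwartz_seminorm k bs (tensor f g) \<le> C * schwartz_seminorm k cs f"
proof -
  define \<A> :: "('n phase_fun \<Rightarrow> 'n phase2_fun) set"
    where "\<A> = (\<lambda>g f. tensor f g) ` schwartz"
  have diff: "\<forall>f\<in>schwartz. \<forall>x. A f differentiable (at x)" if "A \<in> \<A>" for A
    using that tensor_dir_deriv(1) by (auto simp: \<A>_def)
  have comm: "\<exists>A'\<in>\<A>. \<exists>cs\<in>lists Basis. \<forall>f\<in>schwartz. dir_deriv b (A f) = A' (iter_deriv cs f)"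
    if A: "A \<in> \<A>" and b: "b \<in> Basis" for A and b :: "'n phase \<times> 'n phase"
  proof -
    obtain g where g: "g \<in> schwartz" "A = (\<lambda>f. tensor f g)" using A by (auto simp: \<A>_def)
    obtain c where "c \<in> Basis" and "b = (c, 0) \<or> b = (0, c)"
      using b by (auto simp: Basis_prod_def[where 'a = "'n phase" and 'b = "'n phase"])
    then consider (1) "c \<in> Basis" "b = (c, 0)" | (2) "c \<in> Basis" "b = (0, c)" by blast
    then show ?thesis
    proof cases
      case 1
      then have "\<forall>f\<in>schwartz. dir_deriv b (A f) = A (iter_deriv [c] f)"
        using g by (simp add: tensor_dir_deriv)
      with A 1(1) show ?thesis by (intro bexI[of _ A] bexI[of _ "[c]"]) auto
    next
      case 2
      then have "\<forall>f\<in>schwartz. dir_deriv b (A f) = tensor (iter_deriv [] f) (dir_deriv c g)"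
        using g by (simp add: tensor_dir_deriv)
      moreover have "(\<lambda>f. tensor f (dir_deriv c g)) \<in> \<A>"
        using schwartz_dir_deriv[OF g(1) 2(1)] by (auto simp: \<A>_def)
      ultimately show ?thesis
        by (intro bexI[of _ "\<lambda>f. tensor f (dir_deriv c g)"] bexI[of _ "[]"]) auto
    qed
  qed
  have bound: "\<exists>C\<ge>0. \<forall>f\<in>schwartz. \<forall>x. (1 + norm x) ^ k * cmod (A f x) \<le> C * schwartz_seminorm k [] f"
    if A: "A \<in> \<A>" for A k
  proof -
    obtain g where g: "g \<in> schwartz" "A = (\<lambda>f. tensor f g)" using A by (auto simp: \<A>_def)
    have "(1 + norm z) ^ k * cmod (A f z) \<le> schwartz_seminorm k [] g * schwartz_seminorm k [] f"
      if f: "f \<in> schwartz" for f z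
    proof -
      obtain x y where z: "z = (x, y)" by (rule prod.exhaust)
      \<comment> \<open>Adding the product \<open>norm x * norm y\<close> completes the bound to a
        product, so that the weight splits between the two factors.\<close>
      have "norm z \<le> norm x + norm y" unfolding z by (rule norm_Pair_le)
      also have "\<dots> \<le> norm x + norm y + norm x * norm y" by simp
      finally have "1 + norm z \<le> (1 + norm y) * (1 + norm x)" by (simp add: algebra_simps)
      then have "(1 + norm z) ^ k \<le> ((1 + norm y) * (1 + norm x)) ^ k"
        by (intro power_mono) auto
      then have "(1 + norm z) ^ k * cmod (A f z)
          \<le> ((1 + norm y) * (1 + norm x)) ^ k * (cmod (g y) * cmod (f x))"
        unfolding g(2) z tensor_def by (intro mult_mono) (auto simp: norm_mult)
      also have "\<dots> = ((1 + norm y) ^ k * cmod (g y)) * ((1 + norm x) ^ k * cmod (f x))"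
        by (simp add: power_mult_distrib ac_simps)
      also have "\<dots> \<le> schwartz_seminorm k [] g * schwartz_seminorm k [] f"
        by (intro mult_mono schwartz_bound0 f g schwartz_seminorm_nonneg) auto
      finally show ?thesis .
    qed
    moreover have "schwartz_seminorm k [] g \<ge> 0" using g(1) by (intro schwartz_seminorm_nonneg) auto
    ultimately show ?thesis by blast
  qed
  have "(\<lambda>f. tensor f g) \<in> \<A>" using g by (auto simp: \<A>_def)
  note * = schwartz_operator_family[of \<A>, OF diff comm bound this]
  show "\<forall>f\<in>schwartz. tensor f g \<in> schwartz"
    and "\<forall>k. \<forall>bs\<in>lists Basis. \<exists>cs\<in>lists Basis. \<exists>C\<ge>0. \<forall>f\<in>schwartz.
      schwartz_seminorm k bs (tensor f g) \<le> C * schwartz_seminorm k cs f"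
    using * by blast+
qed

text \<open>Mean value inequality: the sum of the suprema of the partial derivatives bounds the
  operator norm of the derivative at every point.\<close>

lemma schwartz_lipschitz:
  assumes "f \<in> schwartz"
  shows "\<exists>K\<ge>0. \<forall>x y. cmod (f x - f y) \<le> K * norm (x - y)"
proof -
  define K where "K = (\<Sum>b\<in>Basis. schwartz_seminorm 0 [b] f)"
  have K0: "K \<ge> 0" unfolding K_def using assms by (intro sum_nonneg schwartz_seminorm_nonneg) auto
  have "onorm (\<lambda>v. \<Sum>b\<in>Basis. (v \<bullet> b) *\<^sub>R dir_deriv b f x) \<le> K" for x
  proof (rule onorm_bound[OF K0])
    fix v :: 'a
    have "norm (\<Sum>b\<in>Basis. (v \<bullet> b) *\<^sub>R dir_deriv b f x) \<le> (\<Sum>b\<in>Basis. norm v * schwartz_seminorm 0 [b] f)"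
    proof (rule sum_norm_le)
      fix b :: 'a assume b: "b \<in> Basis"
      have "norm ((v \<bullet> b) *\<^sub>R dir_deriv b f x) = \<bar>v \<bullet> b\<bar> * cmod (dir_deriv b f x)" by simp
      also have "\<dots> \<le> norm v * schwartz_seminorm 0 [b] f"
        using schwartz_bound[OF assms, of "[b]" x 0] b
        by (intro mult_mono) (auto simp: Basis_le_norm)
      finally show "norm ((v \<bullet> b) *\<^sub>R dir_deriv b f x) \<le> norm v * schwartz_seminorm 0 [b] f" .
    qed
    then show "norm (\<Sum>b\<in>Basis. (v \<bullet> b) *\<^sub>R dir_deriv b f x) \<le> K * norm v"
      by (simp add: K_def sum_distrib_left sum_distrib_right mult.commute)
  qed
  then have "cmod (f x - f y) \<le> K * norm (x - y)" for x y
    using schwartz_has_derivative[OF assms] by (intro differentiable_bound[of UNIV]) auto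
  with K0 show ?thesis by blast
qed

text \<open>The partial derivatives are Lipschitz, so along the segment from \<open>x\<close> to
  \<open>x + w\<close> the derivative differs from the one at \<open>x\<close> by at most
  \<open>K * norm w\<close>. Since \<open>K\<close> does not depend on \<open>x\<close>, the
  remainder can later be integrated over one of the variables.\<close>

lemma schwartz_taylor:
  assumes f: "f \<in> schwartz"
  shows "\<exists>K\<ge>0. \<forall>x w. cmod (f (x + w) - f x - (\<Sum>b\<in>Basis. (w \<bullet> b) *\<^sub>R dir_deriv b f x)) \<le> K * (norm w)\<^sup>2"
proof -
  have "\<exists>K\<ge>0. \<forall>x y. cmod (dir_deriv b f x - dir_deriv b f y) \<le> K * norm (x - y)" if "b \<in> Basis" for b
    using schwartz_lipschitz[OF schwartz_dir_deriv[OF f that]] .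
  then obtain L where L: "\<And>b. b \<in> Basis \<Longrightarrow> L b \<ge> 0"
    "\<And>b x y. b \<in> Basis \<Longrightarrow> cmod (dir_deriv b f x - dir_deriv b f y) \<le> L b * norm (x - y)" by metis
  define K where "K = sum L Basis"
  have K0: "K \<ge> 0" unfolding K_def using L(1) by (rule sum_nonneg)
  let ?D = "\<lambda>x v. \<Sum>b\<in>Basis. (v \<bullet> b) *\<^sub>R dir_deriv b f x"
  have "norm (f (x + w) - f x - ?D x w) \<le> K * (norm w)\<^sup>2" for x w
  proof -
    have "norm (f (x + w) - f x - ?D x (x + w - x)) \<le> norm (x + w - x) * (K * norm w)"
    proof (rule differentiable_bound_linearization[where S = "closed_segment x (x + w)"])
      show "x + t *\<^sub>R (x + w - x) \<in> closed_segment x (x + w)" if "t \<in> {0..1}" for t :: real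
        using that by (auto simp: in_segment algebra_simps intro!: exI[of _ t])
      show "(f has_derivative ?D y) (at y within closed_segment x (x + w))" for y
        using schwartz_has_derivative[OF f] by (rule has_derivative_at_withinI)
      fix y assume "y \<in> closed_segment x (x + w)"
      then have y: "norm (y - x) \<le> norm w" using segment_bound1[of y x "x + w"] by simp
      show "onorm (?D y - ?D x) \<le> K * norm w"
      proof (rule onorm_bound)
        fix v :: 'a
        have "norm ((?D y - ?D x) v) = norm (\<Sum>b\<in>Basis. (v \<bullet> b) *\<^sub>R (dir_deriv b f y - dir_deriv b f x))"
          by (simp add: scaleR_diff_right sum_subtractf)
        also have "\<dots> \<le> (\<Sum>b\<in>Basis. norm v * (L b * norm w))"
        proof (rule sum_norm_le)
          fix b :: 'a assume b: "b \<in> Basis"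
          have "norm ((v \<bullet> b) *\<^sub>R (dir_deriv b f y - dir_deriv b f x))
              = \<bar>v \<bullet> b\<bar> * cmod (dir_deriv b f y - dir_deriv b f x)" by simp
          also have "\<dots> \<le> norm v * (L b * norm w)"
            using order_trans[OF L(2)[OF b] mult_left_mono[OF y L(1)[OF b]]] b
            by (intro mult_mono) (auto simp: Basis_le_norm)
          finally show "norm ((v \<bullet> b) *\<^sub>R (dir_deriv b f y - dir_deriv b f x)) \<le> norm v * (L b * norm w)" .
        qed
        finally show "norm ((?D y - ?D x) v) \<le> K * norm w * norm v"
          by (simp add: K_def sum_distrib_left sum_distrib_right ac_simps)
      qed (use K0 in simp)
    qed simp
    then show ?thesis by (simp add: power2_eq_square ac_simps)
  qed
  with K0 show ?thesis by blast
qed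

lemma has_derivative_quadratic_remainder:
  fixes f :: "'a::real_normed_vector \<Rightarrow> 'b::real_normed_vector"
  assumes D: "bounded_linear D" and le: "\<And>w. norm (f (x + w) - f x - D w) \<le> K * (norm w)\<^sup>2"
  shows "(f has_derivative D) (at x)"
  unfolding has_derivative_at
proof (intro conjI D)
  have "((\<lambda>w::'a. K * norm w) \<longlongrightarrow> K * norm (0::'a)) (at 0)"
    by (intro tendsto_mult tendsto_const tendsto_norm[OF tendsto_ident_at])
  then have lim: "((\<lambda>w::'a. K * norm w) \<longlongrightarrow> 0) (at 0)" by simp
  show "(\<lambda>w. norm (f (x + w) - f x - D w) / norm w) \<midarrow>0\<rightarrow> 0"
  proof (rule tendsto_sandwich[OF _ _ tendsto_const lim])
    show "\<forall>\<^sub>F w in at 0. norm (f (x + w) - f x - D w) / norm w \<le> K * norm w"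
      unfolding eventually_at_filter
      by (rule always_eventually) (use le in \<open>auto simp: divide_le_eq power2_eq_square mult.assoc\<close>)
  qed simp
qed

lemma sum_Basis_prod:
  "sum f (Basis :: ('a::euclidean_space \<times> 'b::euclidean_space) set)
    = (\<Sum>b\<in>Basis. f (b, 0)) + (\<Sum>b\<in>Basis. f (0, b))"
  unfolding Basis_prod_def
  by (subst sum.union_disjoint) (auto simp: sum.reindex inj_on_def)

text \<open>The inner integral of \<open>dist_tensor\<close>, separated as an operator in
  \<open>F\<close> so that it can be transposed.\<close>

definition partial_integral :: "'b measure \<Rightarrow> ('b \<Rightarrow> complex) \<Rightarrow> ('a \<times> 'b \<Rightarrow> complex) \<Rightarrow> 'a \<Rightarrow> complex"
  where "partial_integral \<mu> h F = (\<lambda>x. LINT y|\<mu>. F (x, y) * h y)"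

section \<open>Differentiation under the integral sign\<close>

context
  fixes \<mu> :: "'b::euclidean_space measure" and h :: "'b \<Rightarrow> complex"
  assumes \<mu>: "sets \<mu> = sets borel" and h: "integrable \<mu> h"
begin

text \<open>A Schwartz function is bounded, so a constant multiple of \<open>norm (h y)\<close>
  dominates the integrand.\<close>

lemma partial_integrable:
  fixes F :: "'a::euclidean_space \<times> 'b \<Rightarrow> complex"
  assumes F: "F \<in> schwartz"
  shows "integrable \<mu> (\<lambda>y. F (x, y) * h y)"
proof (rule Bochner_Integration.integrable_bound)
  show "integrable \<mu> (\<lambda>y. schwartz_seminorm 0 [] F * norm (h y))"
    using h by (intro integrable_mult_right integrable_norm)
  have "continuous_on UNIV (\<lambda>y. F (x, y))"
    using schwartz_continuous[OF F]
    by (rule continuous_on_compose2) (intro continuous_on_Pair continuous_on_const continuous_on_id, simp)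
  then have "(\<lambda>y. F (x, y)) \<in> borel_measurable \<mu>"
    unfolding measurable_cong_sets[OF \<mu> refl] by (rule borel_measurable_continuous_onI)
  then show "(\<lambda>y. F (x, y) * h y) \<in> borel_measurable \<mu>"
    using borel_measurable_integrable[OF h] by (rule borel_measurable_times)
  show "AE y in \<mu>. norm (F (x, y) * h y) \<le> norm (schwartz_seminorm 0 [] F * norm (h y))"
  proof (rule AE_I2)
    fix y
    have "norm (F (x, y) * h y) \<le> schwartz_seminorm 0 [] F * norm (h y)"
      unfolding norm_mult by (intro mult_right_mono schwartz_cmod_le[OF F] norm_ge_zero)
    then show "norm (F (x, y) * h y) \<le> norm (schwartz_seminorm 0 [] F * norm (h y))"
      by (rule order_trans) simp
  qed
qed

lemma partial_integral_add:
  fixes F G :: "'a::euclidean_space \<times> 'b \<Rightarrow> complex"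
  assumes "F \<in> schwartz" "G \<in> schwartz"
  shows "partial_integral \<mu> h (F + G) = partial_integral \<mu> h F + partial_integral \<mu> h G"
proof
  fix x
  have "(LINT y|\<mu>. (F (x, y) + G (x, y)) * h y) = (LINT y|\<mu>. F (x, y) * h y + G (x, y) * h y)"
    by (simp only: distrib_right)
  also have "\<dots> = (LINT y|\<mu>. F (x, y) * h y) + (LINT y|\<mu>. G (x, y) * h y)"
    using assms by (intro Bochner_Integration.integral_add partial_integrable)
  finally show "partial_integral \<mu> h (F + G) x = (partial_integral \<mu> h F + partial_integral \<mu> h G) x"
    by (simp only: partial_integral_def plus_fun_apply)
qed

lemma partial_integral_cscale:
  "partial_integral \<mu> h (cscale c F) = cscale c (partial_integral \<mu> h F)"
  by (rule ext) (simp only: partial_integral_def mult.assoc integral_mult_right_zero)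

text \<open>Since \<open>norm x \<le> norm (x, y)\<close>, the weight in \<open>x\<close> can be
  moved under the integral and absorbed into the seminorm of \<open>F\<close> at the same
  \<open>k\<close>.\<close>

lemma cmod_partial_integral_le:
  fixes F :: "'a::euclidean_space \<times> 'b \<Rightarrow> complex"
  assumes F: "F \<in> schwartz"
  shows "(1 + norm x) ^ k * cmod (partial_integral \<mu> h F x)
    \<le> (LINT y|\<mu>. norm (h y)) * schwartz_seminorm k [] F"
proof -
  have "(1 + norm x) ^ k * cmod (partial_integral \<mu> h F x)
      \<le> (1 + norm x) ^ k * (LINT y|\<mu>. cmod (F (x, y) * h y))"
    unfolding partial_integral_def by (intro mult_left_mono integral_norm_bound) simp
  also have "\<dots> = (LINT y|\<mu>. (1 + norm x) ^ k * cmod (F (x, y) * h y))" by simp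
  also have "\<dots> \<le> (LINT y|\<mu>. norm (h y) * schwartz_seminorm k [] F)"
  proof (rule integral_mono)
    show "integrable \<mu> (\<lambda>y. (1 + norm x) ^ k * cmod (F (x, y) * h y))"
      using partial_integrable[OF F] by (intro integrable_mult_right integrable_norm)
    show "integrable \<mu> (\<lambda>y. norm (h y) * schwartz_seminorm k [] F)"
      using h by (intro integrable_mult_left integrable_norm)
    fix y :: 'b
    have "norm x \<le> norm (x, y)" using norm_fst_le[of x y] .
    then have "(1 + norm x) ^ k * cmod (F (x, y)) \<le> (1 + norm (x, y)) ^ k * cmod (F (x, y))"
      by (intro mult_right_mono power_mono) auto
    also have "\<dots> \<le> schwartz_seminorm k [] F" by (rule schwartz_bound0[OF F])
    finally have "cmod (h y) * ((1 + norm x) ^ k * cmod (F (x, y))) \<le> cmod (h y) * schwartz_seminorm k [] F"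
      by (rule mult_left_mono) simp
    then show "(1 + norm x) ^ k * cmod (F (x, y) * h y) \<le> norm (h y) * schwartz_seminorm k [] F"
      by (simp only: norm_mult ac_simps)
  qed
  also have "\<dots> = (LINT y|\<mu>. norm (h y)) * schwartz_seminorm k [] F" by simp
  finally show ?thesis .
qed

text \<open>The Taylor remainder of \<open>F\<close> in the direction \<open>(v, 0)\<close> is
  quadratic in \<open>v\<close> with a constant independent of \<open>y\<close>. Integration against
  \<open>h\<close> multiplies this constant by the integral of \<open>norm (h y)\<close> and keeps
  the remainder quadratic.\<close>

lemma partial_integral_has_derivative:
  fixes F :: "'a::euclidean_space \<times> 'b \<Rightarrow> complex"
  assumes F: "F \<in> schwartz"
  shows "(partial_integral \<mu> h F has_derivative
    (\<lambda>v. \<Sum>b\<in>Basis. (v \<bullet> b) *\<^sub>R partial_integral \<mu> h (dir_deriv (b, 0) F) x)) (at x)"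
proof -
  obtain K where K: "K \<ge> 0" "\<And>z w. cmod (F (z + w) - F z - (\<Sum>b\<in>Basis. (w \<bullet> b) *\<^sub>R dir_deriv b F z))
      \<le> K * (norm w)\<^sup>2"
    using schwartz_taylor[OF F] by blast
  \<comment> \<open>In the direction \<open>(v, 0)\<close> the terms of the basis vectors
    \<open>(0, b)\<close> have coefficient zero.\<close>
  have K': "cmod (F (x + v, y) - F (x, y) - (\<Sum>b\<in>Basis. (v \<bullet> b) *\<^sub>R dir_deriv (b, 0) F (x, y)))
      \<le> K * (norm v)\<^sup>2" for v y
    using K(2)[of "(x, y)" "(v, 0)"] unfolding sum_Basis_prod by (simp add: inner_prod_def norm_Pair)
  have S: "b \<in> Basis \<Longrightarrow> dir_deriv (b, 0) F \<in> schwartz" for b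
    using F by (intro schwartz_dir_deriv) (auto simp: Basis_prod_def)
  show ?thesis
  proof (rule has_derivative_quadratic_remainder)
    show "bounded_linear (\<lambda>v. \<Sum>b\<in>Basis. (v \<bullet> b) *\<^sub>R partial_integral \<mu> h (dir_deriv (b, 0) F) x)"
      by (intro bounded_linear_sum bounded_linear_scaleR_const bounded_linear_inner_left)
    fix v
    let ?R = "\<lambda>y. F (x + v, y) - F (x, y) - (\<Sum>b\<in>Basis. (v \<bullet> b) *\<^sub>R dir_deriv (b, 0) F (x, y))"
    have split: "?R y * h y = F (x + v, y) * h y - F (x, y) * h y
        - (\<Sum>b\<in>Basis. (v \<bullet> b) *\<^sub>R (dir_deriv (b, 0) F (x, y) * h y))" for y
      by (simp only: left_diff_distrib sum_distrib_right mult_scaleR_left)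
    have int: "integrable \<mu> (\<lambda>y. (v \<bullet> b) *\<^sub>R (dir_deriv (b, 0) F (x, y) * h y))" if "b \<in> Basis" for b
      using S[OF that] by (intro integrable_scaleR_right partial_integrable)
    have intR: "integrable \<mu> (\<lambda>y. ?R y * h y)"
      unfolding split using int
      by (intro Bochner_Integration.integrable_diff Bochner_Integration.integrable_sum partial_integrable F)
    have intS: "integrable \<mu> (\<lambda>y. \<Sum>b\<in>Basis. (v \<bullet> b) *\<^sub>R (dir_deriv (b, 0) F (x, y) * h y))"
      using int by (rule Bochner_Integration.integrable_sum)
    have "(LINT y|\<mu>. ?R y * h y) = (LINT y|\<mu>. F (x + v, y) * h y) - (LINT y|\<mu>. F (x, y) * h y)
        - (LINT y|\<mu>. (\<Sum>b\<in>Basis. (v \<bullet> b) *\<^sub>R (dir_deriv (b, 0) F (x, y) * h y)))"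
      unfolding split Bochner_Integration.integral_diff[OF Bochner_Integration.integrable_diff[OF
          partial_integrable[OF F] partial_integrable[OF F]] intS]
        Bochner_Integration.integral_diff[OF partial_integrable[OF F] partial_integrable[OF F]] ..
    also have "(LINT y|\<mu>. (\<Sum>b\<in>Basis. (v \<bullet> b) *\<^sub>R (dir_deriv (b, 0) F (x, y) * h y)))
        = (\<Sum>b\<in>Basis. (v \<bullet> b) *\<^sub>R partial_integral \<mu> h (dir_deriv (b, 0) F) x)"
      unfolding partial_integral_def
      by (subst Bochner_Integration.integral_sum[OF int]) (simp_all only: integral_scaleR_right)
    finally have "partial_integral \<mu> h F (x + v) - partial_integral \<mu> h F x -
        (\<Sum>b\<in>Basis. (v \<bullet> b) *\<^sub>R partial_integral \<mu> h (dir_deriv (b, 0) F) x) = (LINT y|\<mu>. ?R y * h y)"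
      unfolding partial_integral_def by (rule sym)
    also have "norm \<dots> \<le> (LINT y|\<mu>. norm (?R y * h y))" by (rule integral_norm_bound)
    also have "\<dots> \<le> (LINT y|\<mu>. norm (h y) * (K * (norm v)\<^sup>2))"
    proof (rule integral_mono)
      show "integrable \<mu> (\<lambda>y. norm (?R y * h y))" using intR by (rule integrable_norm)
      show "integrable \<mu> (\<lambda>y. norm (h y) * (K * (norm v)\<^sup>2))"
        using h by (intro integrable_mult_left integrable_norm)
      show "norm (?R y * h y) \<le> norm (h y) * (K * (norm v)\<^sup>2)" for y
        unfolding norm_mult using mult_left_mono[OF K' norm_ge_zero, of "h y" v y]
        by (simp add: mult.commute)
    qed
    also have "\<dots> = ((LINT y|\<mu>. norm (h y)) * K) * (norm v)\<^sup>2" by (simp add: mult.assoc)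
    finally show "norm (partial_integral \<mu> h F (x + v) - partial_integral \<mu> h F x -
        (\<Sum>b\<in>Basis. (v \<bullet> b) *\<^sub>R partial_integral \<mu> h (dir_deriv (b, 0) F) x))
      \<le> ((LINT y|\<mu>. norm (h y)) * K) * (norm v)\<^sup>2" .
  qed
qed

text \<open>The derivative along \<open>b\<close> of the integral is the same operator applied to
  the derivative of \<open>F\<close> along \<open>(b, 0)\<close>, so again a family with one member
  is stable.\<close>

lemma partial_integral_schwartz:
  shows "\<forall>F\<in>schwartz. partial_integral \<mu> h F \<in> (schwartz :: ('a::euclidean_space \<Rightarrow> complex) set)"
    and "\<forall>k. \<forall>bs\<in>lists (Basis :: 'a::euclidean_space set). \<exists>cs\<in>lists Basis. \<exists>C\<ge>0. \<forall>F\<in>schwartz.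
      schwartz_seminorm k bs (partial_integral \<mu> h F) \<le> C * schwartz_seminorm k cs F"
proof -
  define \<A> :: "(('a \<times> 'b \<Rightarrow> complex) \<Rightarrow> 'a \<Rightarrow> complex) set" where "\<A> = {partial_integral \<mu> h}"
  have diff: "\<forall>f\<in>schwartz. \<forall>x. A f differentiable (at x)" if "A \<in> \<A>" for A
    using that partial_integral_has_derivative differentiableI unfolding \<A>_def by blast
  have comm: "\<exists>A'\<in>\<A>. \<exists>cs\<in>lists Basis. \<forall>F\<in>schwartz. dir_deriv b (A F) = A' (iter_deriv cs F)"
    if A: "A \<in> \<A>" and b: "b \<in> Basis" for A and b :: 'a
  proof -
    have "dir_deriv b (partial_integral \<mu> h F) x = partial_integral \<mu> h (dir_deriv (b, 0) F) x"
      if "F \<in> schwartz" for x and F :: "'a \<times> 'b \<Rightarrow> complex"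
      unfolding dir_deriv_eqI[OF partial_integral_has_derivative[OF that]]
      using b by (simp add: inner_Basis if_distrib[of "\<lambda>r. r *\<^sub>R _"] sum.delta cong: if_cong)
    then have "\<forall>F\<in>schwartz. dir_deriv b (A F) = A (iter_deriv [(b, 0)] F)"
      using A by (auto simp: \<A>_def)
    moreover have "[(b, 0)] \<in> lists Basis" using b by (auto simp: Basis_prod_def)
    ultimately show ?thesis using A by blast
  qed
  have bound: "\<exists>C\<ge>0. \<forall>f\<in>schwartz. \<forall>x. (1 + norm x) ^ k * cmod (A f x) \<le> C * schwartz_seminorm k [] f"
    if "A \<in> \<A>" for A k
    using that cmod_partial_integral_le unfolding \<A>_def
    by (intro exI[of _ "LINT y|\<mu>. norm (h y)"]) auto
  have "partial_integral \<mu> h \<in> \<A>" by (simp add: \<A>_def)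
  note * = schwartz_operator_family[of \<A>, OF diff comm bound this]
  show "\<forall>F\<in>schwartz. partial_integral \<mu> h F \<in> (schwartz :: ('a \<Rightarrow> complex) set)"
    and "\<forall>k. \<forall>bs\<in>lists (Basis :: 'a set). \<exists>cs\<in>lists Basis. \<exists>C\<ge>0. \<forall>F\<in>schwartz.
      schwartz_seminorm k bs (partial_integral \<mu> h F) \<le> C * schwartz_seminorm k cs F"
    using * by blast+
qed

end

section \<open>Banach norms on spaces of functions\<close>

lemma cnorm_onD:
  assumes "cnorm_on V \<nu>"
  shows "cfun.subspace V"
    and "u \<in> V \<Longrightarrow> 0 \<le> \<nu> u"
    and "u \<in> V \<Longrightarrow> \<nu> u = 0 \<longleftrightarrow> u = 0"
    and "u \<in> V \<Longrightarrow> \<nu> (cscale c u) = cmod c * \<nu> u"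
    and "u \<in> V \<Longrightarrow> v \<in> V \<Longrightarrow> \<nu> (u + v) \<le> \<nu> u + \<nu> v"
    and "u \<in> V \<Longrightarrow> v \<in> V \<Longrightarrow> u - v \<in> V"
  using assms cfun.subspace_diff unfolding cnorm_on_def by blast+

lemma cnorm_on_minus_commute:
  assumes "cnorm_on V \<nu>" "u \<in> V" "v \<in> V"
  shows "\<nu> (u - v) = \<nu> (v - u)"
proof -
  have "cscale (-1) (v - u) = u - v" by (auto simp: fun_eq_iff)
  then show ?thesis
    using cnorm_onD(4)[OF assms(1) cnorm_onD(6)[OF assms(1,3,2)], of "-1"] by simp
qed

text \<open>Completeness expressed through the norm. All points involved lie in \<open>V\<close>, so
  the default value of \<open>norm_dist\<close> disappears.\<close>

lemma banach_on_iff: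
  "banach_on V \<nu> \<longleftrightarrow> cnorm_on V \<nu> \<and>
    (\<forall>s. (\<forall>n. s n \<in> V) \<and> (\<forall>e>0. \<exists>N. \<forall>m\<ge>N. \<forall>n\<ge>N. \<nu> (s m - s n) < e)
      \<longrightarrow> (\<exists>x\<in>V. (\<lambda>n. \<nu> (s n - x)) \<longlonglongrightarrow> 0))"
proof (cases "cnorm_on V \<nu>")
  case True
  then interpret Metric_space V "norm_dist V \<nu>" by (rule Metric_space_norm_dist)
  have Cauchy: "MCauchy s \<longleftrightarrow> (\<forall>n. s n \<in> V) \<and> (\<forall>e>0. \<exists>N. \<forall>m\<ge>N. \<forall>n\<ge>N. \<nu> (s m - s n) < e)" for s
    unfolding MCauchy_def norm_dist_def by (simp add: image_subset_iff cong: conj_cong)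
  have lim: "limitin mtopology s x sequentially \<longleftrightarrow> x \<in> V \<and> (\<lambda>n. \<nu> (s n - x)) \<longlonglongrightarrow> 0"
    if "\<forall>n. s n \<in> V" for s x
  proof (cases "x \<in> V")
    case x: True
    have "0 \<le> \<nu> (s n - x)" for n
      using cnorm_onD(2,6)[OF True] that x by blast
    then show ?thesis
      unfolding limit_metric_sequentially LIMSEQ_iff
      using that x by (simp add: norm_dist_def)
  qed (simp add: limit_metric_sequentially)
  show ?thesis
    unfolding banach_on_def mcomplete_def Cauchy using True lim by blast
qed (simp add: banach_on_def)

lemma banach_onI:
  assumes "cnorm_on V \<nu>"
    and "\<And>s. (\<And>n. s n \<in> V) \<Longrightarrow> \<forall>e>0. \<exists>N. \<forall>m\<ge>N. \<forall>n\<ge>N. \<nu> (s m - s n) < e \<Longrightarrow>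
      \<exists>x\<in>V. (\<lambda>n. \<nu> (s n - x)) \<longlonglongrightarrow> 0"
  shows "banach_on V \<nu>"
  unfolding banach_on_iff using assms by simp

lemma banach_on_limitE:
  assumes "banach_on V \<nu>" "\<And>n. s n \<in> V" "\<forall>e>0. \<exists>N. \<forall>m\<ge>N. \<forall>n\<ge>N. \<nu> (s m - s n) < e"
  obtains x where "x \<in> V" "(\<lambda>n. \<nu> (s n - x)) \<longlonglongrightarrow> 0"
  using assms unfolding banach_on_iff by blast

text \<open>With \<open>e\<close> the evaluation of \<open>S u\<close> at a Schwartz function, this
  converts convergence in the norm of \<open>L\<close> into convergence of numbers.\<close>

lemma continuously_embedded_eval:
  assumes "cnorm_on V \<nu>" "continuously_embedded V \<nu> X"
    and "\<And>n. s n \<in> V" "x \<in> V" "(\<lambda>n. \<nu> (s n - x)) \<longlonglongrightarrow> 0"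
    and "continuous_map X euclidean e"
  shows "(\<lambda>n. e (s n)) \<longlonglongrightarrow> e x"
proof -
  interpret Metric_space V "norm_dist V \<nu>" using assms(1) by (rule Metric_space_norm_dist)
  have "0 \<le> \<nu> (s n - x)" for n using cnorm_onD(2,6)[OF assms(1)] assms(3,4) by blast
  then have "limitin mtopology s x sequentially"
    using assms(3-5) unfolding limit_metric_sequentially LIMSEQ_iff by (simp add: norm_dist_def)
  moreover have "continuous_map mtopology X (\<lambda>u. u)"
    using assms(2) by (simp add: continuously_embedded_def)
  ultimately have "limitin X ((\<lambda>u. u) \<circ> s) ((\<lambda>u. u) x) sequentially"
    using continuous_map_limit[of mtopology X "\<lambda>u. u"] by blast
  then have "limitin X s x sequentially" by (simp only: o_def)
  from continuous_map_limit[OF assms(6) this] show ?thesis by (simp add: o_def)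
qed

text \<open>The closed graph theorem for the identity map between two norms. Baire's theorem yields
  a ball of the first norm in the closure of a ball of the second; the factor \<open>1/2\<close> then allows
  to represent a vector by a series converging in both norms.\<close>

lemma banach_on_norm_le:
  assumes B1: "banach_on V \<nu>\<^sub>1" and B2: "banach_on V \<nu>\<^sub>2"
    and consistent: "\<And>s x y. (\<And>n. s n \<in> V) \<Longrightarrow> x \<in> V \<Longrightarrow> y \<in> V \<Longrightarrow>
      (\<lambda>n. \<nu>\<^sub>1 (s n - x)) \<longlonglongrightarrow> 0 \<Longrightarrow> (\<lambda>n. \<nu>\<^sub>2 (s n - y)) \<longlonglongrightarrow> 0 \<Longrightarrow> x = y"
  shows "\<exists>C>0. \<forall>u\<in>V. \<nu>\<^sub>2 u \<le> C * \<nu>\<^sub>1 u"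
proof -
  have n1: "cnorm_on V \<nu>\<^sub>1" and n2: "cnorm_on V \<nu>\<^sub>2" using B1 B2 by (simp_all add: banach_on_def)
  note N1 = cnorm_onD[OF n1] and N2 = cnorm_onD[OF n2]
  have V0: "0 \<in> V" and Vadd: "\<And>u v. u \<in> V \<Longrightarrow> v \<in> V \<Longrightarrow> u + v \<in> V"
    and Vsc: "\<And>c u. u \<in> V \<Longrightarrow> cscale c u \<in> V"
    using N1(1) by (auto simp: cfun.subspace_def)
  interpret Metric_space V "norm_dist V \<nu>\<^sub>1" using n1 by (rule Metric_space_norm_dist)
  \<comment> \<open>Every vector has finite second norm, so these balls exhaust \<open>V\<close>;
    Baire's theorem is applied to their closures in the first norm.\<close>
  define A where "A k = {u \<in> V. \<nu>\<^sub>2 u \<le> real k}" for k :: nat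
  have "V \<subseteq> (\<Union>k. mtopology closure_of A k)"
  proof
    fix u assume u: "u \<in> V"
    obtain k where "\<nu>\<^sub>2 u \<le> real k" using real_arch_simple by blast
    then have "u \<in> A k" using u by (simp add: A_def)
    moreover have "A k \<subseteq> mtopology closure_of A k"
      by (rule closure_of_subset) (auto simp: A_def)
    ultimately show "u \<in> (\<Union>k. mtopology closure_of A k)" by blast
  qed
  then have "(\<Union>k. mtopology closure_of A k) = V"
    using closure_of_subset_topspace[of mtopology] by fastforce
  moreover have "mtopology interior_of V \<noteq> {}"
    using interior_of_topspace[of mtopology] V0 by auto
  ultimately have "mtopology interior_of \<Union>(range (\<lambda>k. mtopology closure_of A k)) \<noteq> {}" by simp
  moreover have mcomplete using B1 by (simp add: banach_on_def)
  ultimately have "\<not> (\<forall>T\<in>range (\<lambda>k. mtopology closure_of A k).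
      closedin mtopology T \<and> mtopology interior_of T = {})"
    using metric_Baire_category_alt[OF _ countable_image[OF countableI_type]] by metis
  then obtain k where "mtopology interior_of (mtopology closure_of A k) \<noteq> {}"
    using closedin_closure_of[of mtopology] by blast
  then obtain x0 where x0': "x0 \<in> mtopology interior_of (mtopology closure_of A k)" by blast
  have "openin mtopology (mtopology interior_of (mtopology closure_of A k))"
    by (rule openin_interior_of)
  then have "mtopology interior_of (mtopology closure_of A k) \<subseteq> V"
    and "\<exists>r>0. mball x0 r \<subseteq> mtopology interior_of (mtopology closure_of A k)"
    using x0' by (simp_all only: openin_mtopology)
  then obtain r where r: "r > 0" "mball x0 r \<subseteq> mtopology interior_of (mtopology closure_of A k)"
    and x0: "x0 \<in> V" using x0' by blast
  have ball: "mball x0 r \<subseteq> mtopology closure_of A k"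
    using r(2) interior_of_subset by (rule order_trans)
  have approx: "\<exists>w\<in>A k. \<nu>\<^sub>1 (z - w) < e" if z: "z \<in> V" "\<nu>\<^sub>1 (z - x0) < r" and e: "e > 0" for z e
  proof -
    have "z \<in> mball x0 r"
      using z x0 cnorm_on_minus_commute[OF n1 z(1) x0] by (simp add: norm_dist_def)
    then have "z \<in> mtopology closure_of A k" using ball by blast
    then obtain w where w: "w \<in> A k" "w \<in> mball z e"
      using e unfolding metric_closure_of by blast
    then have "\<nu>\<^sub>1 (z - w) < e" by (auto simp: norm_dist_def)
    with w(1) show ?thesis by blast
  qed
  \<comment> \<open>In the next step \<open>w\<close> is a difference of two elements of
    \<open>A k\<close>, of second norm at most \<open>2 * real k\<close>, rescaled by
    \<open>2 * \<nu>\<^sub>1 u / r\<close>. Writing \<open>real k + 1\<close> for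
    \<open>real k\<close> keeps \<open>K\<close> positive.\<close>
  define K where "K = 4 * (real k + 1) / r"
  have K: "K > 0" using r(1) by (simp add: K_def)
  have step: "\<exists>w\<in>V. \<nu>\<^sub>2 w \<le> K * \<nu>\<^sub>1 u \<and> \<nu>\<^sub>1 (u - w) \<le> \<nu>\<^sub>1 u / 2" if u: "u \<in> V" for u
  proof (cases "u = 0")
    case True
    have "\<nu>\<^sub>1 0 = 0" "\<nu>\<^sub>2 0 = 0" using N1(3)[OF V0] N2(3)[OF V0] by simp_all
    then show ?thesis using V0 True by (intro bexI[of _ 0]) simp_all
  next
    case False
    define t where "t = \<nu>\<^sub>1 u"
    have t: "t > 0" using N1(2,3)[OF u] False by (simp add: t_def)
    \<comment> \<open>Scales \<open>u\<close> to first norm \<open>r / 2\<close>, so that its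
      translate by \<open>x0\<close> lies inside the ball.\<close>
    define a where "a = r / (2 * t)"
    have a: "a > 0" using r(1) t by (simp add: a_def)
    let ?au = "cscale (of_real a) u"
    have au: "?au \<in> V" by (rule Vsc[OF u])
    have nau: "\<nu>\<^sub>1 ?au = r / 2" 
    proof -
      have "\<nu>\<^sub>1 ?au = a * t" using N1(4)[OF u, of "of_real a"] a by (simp add: t_def)
      then show ?thesis using t by (simp add: a_def)
    qed
    \<comment> \<open>The ball is centred at \<open>x0\<close> and not at 0. Approximating both
      \<open>?au + x0\<close> and \<open>x0\<close> and subtracting removes the centre; the two
      errors \<open>r / 8\<close> add up to \<open>r / 4\<close>, half the first norm of
      \<open>?au\<close>.\<close>
    have "?au + x0 - x0 = ?au" "x0 - x0 = 0" by (rule add_diff_cancel_right', rule diff_self)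
    then have z: "\<nu>\<^sub>1 (?au + x0 - x0) < r" "\<nu>\<^sub>1 (x0 - x0) < r"
      using nau N1(3)[OF V0] r(1) by simp_all
    obtain w1 where w1: "w1 \<in> A k" "\<nu>\<^sub>1 (?au + x0 - w1) < r / 8"
      using approx[OF Vadd[OF au x0] z(1), of "r / 8"] r(1) by auto
    obtain w2 where w2: "w2 \<in> A k" "\<nu>\<^sub>1 (x0 - w2) < r / 8"
      using approx[OF x0 z(2), of "r / 8"] r(1) by auto
    have wV: "w1 \<in> V" "w2 \<in> V" and w2n: "\<nu>\<^sub>2 w1 \<le> real k" "\<nu>\<^sub>2 w2 \<le> real k"
      using w1(1) w2(1) by (simp_all add: A_def)
    have dV: "w1 - w2 \<in> V" using wV by (rule N1(6))
    have *: "\<nu>\<^sub>1 (?au - (w1 - w2)) < r / 4"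
    proof -
      have eq: "?au - (w1 - w2) = (?au + x0 - w1) + (w2 - x0)" by (rule ext) simp
      have "\<nu>\<^sub>1 (?au - (w1 - w2)) \<le> \<nu>\<^sub>1 (?au + x0 - w1) + \<nu>\<^sub>1 (w2 - x0)"
        unfolding eq using N1(6)[OF Vadd[OF au x0] wV(1)] N1(6)[OF wV(2) x0] by (rule N1(5))
      also have "\<dots> < r / 8 + r / 8"
        using w1(2) w2(2) cnorm_on_minus_commute[OF n1 wV(2) x0] by simp
      finally show ?thesis by simp
    qed
    have **: "\<nu>\<^sub>2 (w1 - w2) \<le> 2 * real k"
    proof -
      have "w1 - w2 = w1 + cscale (-1) w2" by (rule ext) simp
      then have "\<nu>\<^sub>2 (w1 - w2) \<le> \<nu>\<^sub>2 w1 + \<nu>\<^sub>2 (cscale (-1) w2)"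
        using N2(5)[OF wV(1) Vsc[OF wV(2), of "-1"]] by metis
      also have "\<nu>\<^sub>2 (cscale (-1) w2) = \<nu>\<^sub>2 w2" using N2(4)[OF wV(2), of "-1"] by simp
      finally show ?thesis using w2n by linarith
    qed
    let ?w = "cscale (of_real (1 / a)) (w1 - w2)"
    have na: "cmod (of_real (1 / a)) = 1 / a" using a by (simp add: norm_divide)
    have eq: "u - ?w = cscale (of_real (1 / a)) (?au - (w1 - w2))"
      using a by (intro ext) (simp add: field_simps)
    have "\<nu>\<^sub>1 (u - ?w) = \<nu>\<^sub>1 (?au - (w1 - w2)) / a"
      unfolding eq N1(4)[OF N1(6)[OF au dV]] na by simp
    also have "\<dots> \<le> (r / 4) / a" using * a by (intro divide_right_mono) auto
    also have "\<dots> = \<nu>\<^sub>1 u / 2" using r(1) t by (simp add: a_def field_simps flip: t_def)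
    finally have 1: "\<nu>\<^sub>1 (u - ?w) \<le> \<nu>\<^sub>1 u / 2" .
    have "\<nu>\<^sub>2 ?w = \<nu>\<^sub>2 (w1 - w2) / a"
      unfolding N2(4)[OF dV] na by simp
    also have "\<dots> \<le> (2 * (real k + 1)) / a" using ** a by (intro divide_right_mono) auto
    also have "\<dots> = K * \<nu>\<^sub>1 u" using r(1) t by (simp add: a_def K_def field_simps flip: t_def)
    finally show ?thesis using 1 Vsc[OF dV] by blast
  qed
  then obtain W where W: "\<And>u. u \<in> V \<Longrightarrow> W u \<in> V" "\<And>u. u \<in> V \<Longrightarrow> \<nu>\<^sub>2 (W u) \<le> K * \<nu>\<^sub>1 u"
    "\<And>u. u \<in> V \<Longrightarrow> \<nu>\<^sub>1 (u - W u) \<le> \<nu>\<^sub>1 u / 2" by metis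
  have "\<nu>\<^sub>2 u \<le> (4 * K) * \<nu>\<^sub>1 u" if u: "u \<in> V" for u
  proof -
    define t where "t = K * \<nu>\<^sub>1 u"
    have t: "t \<ge> 0" using N1(2)[OF u] K by (simp add: t_def)
    \<comment> \<open>What remains of \<open>u\<close> after \<open>n\<close> rounds of subtracting
      the approximation \<open>W\<close>; its first norm at least halves in each round.\<close>
    define R where "R n = ((\<lambda>v. v - W v) ^^ n) u" for n
    have R: "R 0 = u" "R (Suc n) = R n - W (R n)" for n by (simp_all add: R_def)
    have RV: "R n \<in> V" for n by (induction n) (simp_all only: R u N1(6) W(1))
    have Rn: "\<nu>\<^sub>1 (R n) \<le> \<nu>\<^sub>1 u * (1 / 2) ^ n" for n
    proof (induction n)
      case (Suc n)
      then show ?case using W(3)[OF RV[of n]] unfolding R power_Suc by linarith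
    qed (simp add: R)
    \<comment> \<open>The partial sums of the series of the \<open>W (R i)\<close>, in telescoped
      form.\<close>
    define s where "s n = u - R n" for n
    have sV: "s n \<in> V" for n using N1(6)[OF u RV] by (simp add: s_def)
    have s0: "s 0 = 0" unfolding s_def R by (rule diff_self)
    have sS: "s (Suc n) - s n = W (R n)" for n unfolding s_def R by (rule ext) simp
    have tri: "\<nu>\<^sub>2 (x - z) \<le> \<nu>\<^sub>2 (x - y) + \<nu>\<^sub>2 (y - z)" if "x \<in> V" "y \<in> V" "z \<in> V" for x y z
    proof -
      have "x - z = (x - y) + (y - z)" by (rule ext) simp
      then show ?thesis using N2(5)[OF N2(6)[OF that(1,2)] N2(6)[OF that(2,3)]] by metis
    qed
    have inc: "\<nu>\<^sub>2 (s (Suc n) - s n) \<le> t * (1 / 2) ^ n" for n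
      using order_trans[OF W(2)[OF RV[of n]] mult_left_mono[OF Rn[of n], of K]] K
      unfolding sS t_def mult.assoc by simp
    \<comment> \<open>The last factor is the exact finite geometric sum. The induction closes with
      it; afterwards it is estimated by 1.\<close>
    have far: "\<nu>\<^sub>2 (s (n + j) - s n) \<le> 2 * t * (1 / 2) ^ n * (1 - (1 / 2) ^ j)" for n j
    proof (induction j)
      case 0
      have "s (n + 0) - s n = 0" by simp
      then have "\<nu>\<^sub>2 (s (n + 0) - s n) = 0" using N2(3)[OF V0] by metis
      then show ?case by (simp only: power_0 diff_self mult_zero_right order_refl)
    next
      case (Suc j)
      have "\<nu>\<^sub>2 (s (n + Suc j) - s n) \<le> t * (1 / 2) ^ (n + j) + 2 * t * (1 / 2) ^ n * (1 - (1 / 2) ^ j)"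
        using tri[OF sV[of "Suc (n + j)"] sV[of "n + j"] sV[of n]] inc[of "n + j"] Suc
        unfolding add_Suc_right by linarith
      also have "\<dots> = 2 * t * (1 / 2) ^ n * (1 - (1 / 2) ^ Suc j)"
        by (simp add: power_add algebra_simps)
      finally show ?case .
    qed
    have far': "\<nu>\<^sub>2 (s m - s n) \<le> 2 * t * (1 / 2) ^ n" if "n \<le> m" for m n
    proof -
      have "\<nu>\<^sub>2 (s m - s n) \<le> 2 * t * (1 / 2) ^ n * (1 - (1 / 2) ^ (m - n))"
        using far[of n "m - n"] that by simp
      also have "\<dots> \<le> 2 * t * (1 / 2) ^ n * 1" using t by (intro mult_left_mono) auto
      finally show ?thesis by simp
    qed
    have lim0: "(\<lambda>n. c * (1 / 2 :: real) ^ n) \<longlonglongrightarrow> 0" for c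
      by (intro tendsto_mult_right_zero LIMSEQ_realpow_zero) auto
    have "\<exists>N. \<forall>m\<ge>N. \<forall>n\<ge>N. \<nu>\<^sub>2 (s m - s n) < e" if e: "e > 0" for e
    proof -
      from order_tendstoD(2)[OF lim0[of "2 * t"] e] obtain N where
        N: "\<And>n. n \<ge> N \<Longrightarrow> 2 * t * (1 / 2) ^ n < e" by (auto simp: eventually_sequentially)
      have "\<nu>\<^sub>2 (s m - s n) < e" if "m \<ge> N" "n \<ge> N" for m n
      proof (cases "n \<le> m")
        case True
        then show ?thesis using far'[of n m] N[OF that(2)] by linarith
      next
        case False
        then show ?thesis
          using far'[of m n] N[OF that(1)] cnorm_on_minus_commute[OF n2 sV[of m] sV[of n]] by linarith
      qed
      then show ?thesis by blast
    qed
    then obtain y where y: "y \<in> V" "(\<lambda>n. \<nu>\<^sub>2 (s n - y)) \<longlonglongrightarrow> 0"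
      using B2 sV unfolding banach_on_iff by blast
    have "(\<lambda>n. \<nu>\<^sub>1 (s n - u)) \<longlonglongrightarrow> 0"
    proof (rule tendsto_sandwich[OF _ _ tendsto_const lim0])
      have "\<nu>\<^sub>1 (s n - u) = \<nu>\<^sub>1 (R n)" for n
      proof -
        have "u - s n = R n" unfolding s_def by (rule ext) simp
        then show ?thesis using cnorm_on_minus_commute[OF n1 sV[of n] u] by metis
      qed
      then show "\<forall>\<^sub>F n in sequentially. \<nu>\<^sub>1 (s n - u) \<le> \<nu>\<^sub>1 u * (1 / 2) ^ n"
        using Rn by simp
      show "\<forall>\<^sub>F n in sequentially. 0 \<le> \<nu>\<^sub>1 (s n - u)"
        using N1(2)[OF N1(6)[OF sV u]] by simp
    qed
    \<comment> \<open>The partial sums tend to \<open>u\<close> in the first norm and to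
      \<open>y\<close> in the second. Identifying the limits is the closed graph property.\<close>
    with y have "u = y" using consistent sV u by blast
    have "\<nu>\<^sub>2 u \<le> 2 * t + \<nu>\<^sub>2 (s n - u)" for n
    proof -
      have "u - 0 = u" "s n - 0 = s n" by (rule diff_zero)+
      then have "\<nu>\<^sub>2 u \<le> \<nu>\<^sub>2 (u - s n) + \<nu>\<^sub>2 (s n)" using tri[OF u sV[of n] V0] by metis
      moreover have "\<nu>\<^sub>2 (s n) \<le> 2 * t" using far'[of 0 n] unfolding s0 \<open>s n - 0 = s n\<close> by simp
      ultimately show ?thesis using cnorm_on_minus_commute[OF n2 u sV[of n]] by linarith
    qed
    moreover have "(\<lambda>n. 2 * t + \<nu>\<^sub>2 (s n - u)) \<longlonglongrightarrow> 2 * t + 0"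
      using y(2) unfolding \<open>u = y\<close>[symmetric] by (intro tendsto_intros)
    ultimately have "\<nu>\<^sub>2 u \<le> 2 * t" using LIMSEQ_le_const by fastforce
    then show ?thesis using t by (simp add: t_def)
  qed
  then show ?thesis using K by (intro exI[of _ "4 * K"]) auto
qed

section \<open>Integrability of Schwartz functions\<close>

text \<open>Reduction to dimension one: the function is dominated by a product of one-variable
  functions of the coordinates, and the Lebesgue integral of such a product factorises.\<close>

lemma schwartz_integrable_lborel:
  fixes f :: "'a::euclidean_space \<Rightarrow> complex"
  assumes f: "f \<in> schwartz"
  shows "integrable lborel f"
proof -
  let ?g = "\<lambda>x :: 'a. \<Prod>b\<in>Basis. inverse (1 + (x \<bullet> b)\<^sup>2)"
  \<comment> \<open>There is one factor \<open>1 + (x \<bullet> b)\<^sup>2\<close> for each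
    coordinate, and each is at most \<open>(1 + norm x)\<^sup>2\<close>; hence twice the
    dimension.\<close>
  define C where "C = schwartz_seminorm (2 * DIM('a)) [] f"
  have C: "C \<ge> 0" unfolding C_def using f by (intro schwartz_seminorm_nonneg) auto
  have pos: "0 < 1 + r\<^sup>2" for r :: real by (simp add: add_pos_nonneg)
  have "integrable lborel (\<lambda>x::real. inverse (1 + x\<^sup>2))"
    using integrable_inverse_1_plus_square by (simp add: set_integrable_def einterval_eq_UNIV)
  then have fin: "(\<integral>\<^sup>+x. ennreal (inverse (1 + (x::real)\<^sup>2)) \<partial>lborel) < \<infinity>"
    using pos by (subst (asm) integrable_iff_bounded) (simp add: less_imp_le abs_of_pos)
  have "integrable lborel ?g"
  proof (rule integrableI_bounded)
    have "ennreal (norm (?g x)) = (\<Prod>b\<in>(Basis::'a set). ennreal (inverse (1 + (x \<bullet> b)\<^sup>2)))" for x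
      using pos by (simp add: prod_ennreal less_imp_le prod_nonneg)
    then have "(\<integral>\<^sup>+x. ennreal (norm (?g x)) \<partial>lborel)
        = (\<integral>\<^sup>+x. (\<Prod>b\<in>(Basis::'a set). ennreal (inverse (1 + (x \<bullet> b)\<^sup>2))) \<partial>lborel)"
      by (simp only:)
    also have "\<dots> = (\<Prod>b\<in>(Basis::'a set). \<integral>\<^sup>+x. ennreal (inverse (1 + x\<^sup>2)) \<partial>lborel)"
      by (rule nn_integral_lborel_prod) auto
    also have "\<dots> < \<infinity>" using fin by (simp add: power_less_top_ennreal)
    finally show "(\<integral>\<^sup>+x. ennreal (norm (?g x)) \<partial>lborel) < \<infinity>" .
  qed measurable
  then have "integrable lborel (\<lambda>x. C * ?g x)" by (rule integrable_mult_right)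
  then show ?thesis
  proof (rule Bochner_Integration.integrable_bound)
    show "f \<in> borel_measurable lborel" using schwartz_borel_measurable[OF f] by simp
    show "AE x in lborel. norm (f x) \<le> norm (C * ?g x)"
    proof (rule AE_I2)
      fix x :: 'a
      have "1 + (x \<bullet> b)\<^sup>2 \<le> (1 + norm x)\<^sup>2" if "b \<in> Basis" for b
      proof -
        have "(x \<bullet> b)\<^sup>2 \<le> (norm x)\<^sup>2"
          using power_mono[OF Basis_le_norm[OF that, of x] abs_ge_zero, of 2] by simp
        also have "1 + (norm x)\<^sup>2 \<le> (1 + norm x)\<^sup>2" by (simp add: power2_sum)
        finally show ?thesis by simp
      qed
      then have "(\<Prod>b\<in>(Basis::'a set). 1 + (x \<bullet> b)\<^sup>2) \<le> (\<Prod>b\<in>(Basis::'a set). (1 + norm x)\<^sup>2)"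
        using pos by (intro prod_mono) (auto intro: less_imp_le)
      also have "\<dots> = (1 + norm x) ^ (2 * DIM('a))" by (simp add: power_mult)
      finally have "(\<Prod>b\<in>(Basis::'a set). 1 + (x \<bullet> b)\<^sup>2) * cmod (f x) \<le> C"
        using schwartz_bound0[OF f, of x "2 * DIM('a)"] unfolding C_def
        by (meson mult_right_mono norm_ge_zero order_trans)
      moreover have p: "0 < (\<Prod>b\<in>(Basis::'a set). 1 + (x \<bullet> b)\<^sup>2)" using pos by (rule prod_pos)
      ultimately have "cmod (f x) \<le> C / (\<Prod>b\<in>(Basis::'a set). 1 + (x \<bullet> b)\<^sup>2)"
        by (simp add: pos_le_divide_eq mult.commute)
      also have "\<dots> = C * ?g x" by (simp add: divide_inverse prod_inversef[symmetric] o_def)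
      also have "\<dots> \<le> norm (C * ?g x)" by simp
      finally show "norm (f x) \<le> norm (C * ?g x)" .
    qed
  qed
qed

lemma sets_dXi [simp]: "sets dXi = sets borel"
  by (simp add: dXi_def)

lemma nn_integral_dXi:
  fixes f :: "'n::finite phase \<Rightarrow> ennreal"
  assumes "f \<in> borel_measurable borel"
  shows "nn_integral dXi f = ennreal (1 / (2 * pi) ^ CARD('n)) * nn_integral lborel f"
  unfolding dXi_def using assms by (intro nn_integral_scale_measure) simp

lemma schwartz_integrable_dXi:
  fixes f :: "'n::finite phase_fun"
  assumes f: "f \<in> schwartz"
  shows "integrable dXi f"
proof (rule integrableI_bounded)
  have m: "f \<in> borel_measurable borel" by (rule schwartz_borel_measurable[OF f])
  then show "f \<in> borel_measurable dXi" using measurable_cong_sets[OF sets_dXi refl] by blast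
  have "(\<integral>\<^sup>+x. ennreal (norm (f x)) \<partial>lborel) < \<infinity>"
    using schwartz_integrable_lborel[OF f] by (simp add: integrable_iff_bounded)
  then show "(\<integral>\<^sup>+x. ennreal (norm (f x)) \<partial>dXi) < \<infinity>"
    using m by (simp add: nn_integral_dXi ennreal_mult_less_top)
qed

text \<open>If the integral vanished, \<open>h\<close> would be zero almost everywhere. Its zero set
  is closed by continuity, and a closed set of full measure is the whole space.\<close>

lemma schwartz_L2_norm_nonzero:
  fixes h :: "'n::finite phase_fun"
  assumes h: "h \<in> schwartz" and "h \<noteq> 0"
  shows "(LINT X|dXi. (cnj \<circ> h) X * h X) \<noteq> 0"
proof
  assume 0: "(LINT X|dXi. (cnj \<circ> h) X * h X) = 0"
  have sq: "(cnj \<circ> h) X * h X = of_real ((cmod (h X))\<^sup>2)" for X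
    using complex_norm_square[of "h X"] by (simp add: mult.commute)
  have m: "h \<in> borel_measurable borel" by (rule schwartz_borel_measurable[OF h])
  \<comment> \<open>The Bochner integral of a non-integrable function is 0 by default, so a zero
    integral carries information only once integrability is known.\<close>
  have int: "integrable dXi (\<lambda>X. (cmod (h X))\<^sup>2)"
  proof (rule Bochner_Integration.integrable_bound)
    show "integrable dXi (\<lambda>X. schwartz_seminorm 0 [] h * cmod (h X))"
      using schwartz_integrable_dXi[OF h] by (intro integrable_mult_right integrable_norm)
    have "(\<lambda>X. (cmod (h X))\<^sup>2) \<in> borel_measurable borel" using m by measurable
    then show "(\<lambda>X. (cmod (h X))\<^sup>2) \<in> borel_measurable dXi"
      using measurable_cong_sets[OF sets_dXi refl] by blast
    show "AE X in dXi. norm ((cmod (h X))\<^sup>2) \<le> norm (schwartz_seminorm 0 [] h * cmod (h X))"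
    proof (rule AE_I2)
      fix X
      have "(cmod (h X))\<^sup>2 \<le> schwartz_seminorm 0 [] h * cmod (h X)"
        unfolding power2_eq_square by (intro mult_right_mono schwartz_cmod_le[OF h] norm_ge_zero)
      then show "norm ((cmod (h X))\<^sup>2) \<le> norm (schwartz_seminorm 0 [] h * cmod (h X))" by simp
    qed
  qed
  have "complex_of_real (LINT X|dXi. (cmod (h X))\<^sup>2) = 0"
    using 0 unfolding sq integral_complex_of_real .
  then have "(LINT X|dXi. (cmod (h X))\<^sup>2) = 0" by simp
  then have "(\<integral>\<^sup>+X. ennreal ((cmod (h X))\<^sup>2) \<partial>dXi) = 0"
    using nn_integral_eq_integral[OF int] by simp
  then have "(\<integral>\<^sup>+X. ennreal ((cmod (h X))\<^sup>2) \<partial>lborel) = 0"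
    using m by (simp add: nn_integral_dXi)
  then have "AE X in lborel. h X = 0"
    using m by (simp add: nn_integral_0_iff_AE)
  then have "AE X in lebesgue. X \<in> {X. h X = 0}" by (simp add: AE_completion)
  moreover have "closed {X. h X = 0}"
    using schwartz_continuous[OF h] by (intro closed_Collect_eq) auto
  ultimately have "h X = 0" for X using mem_closed_if_AE_lebesgue by blast
  with \<open>h \<noteq> 0\<close> show False by (auto simp: fun_eq_iff)
qed

section \<open>Induced spaces\<close>

lemma dist_tensor_partial_integral:
  "dist_tensor u h = (\<lambda>\<phi>. if \<phi> \<in> schwartz then u (partial_integral dXi h \<phi>) else 0)"
  unfolding dist_tensor_def partial_integral_def ..

context
  fixes h :: "'n::finite phase_fun"
  assumes h: "h \<in> schwartz"
begin

lemma dist_tensor_tempered: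
  assumes u: "u \<in> tempered"
  shows "dist_tensor u h \<in> tempered"
  unfolding dist_tensor_partial_integral
  using u partial_integral_schwartz(1)[OF sets_dXi schwartz_integrable_dXi[OF h]]
    partial_integral_add[OF sets_dXi schwartz_integrable_dXi[OF h]]
    partial_integral_cscale[OF sets_dXi schwartz_integrable_dXi[OF h]]
    partial_integral_schwartz(2)[OF sets_dXi schwartz_integrable_dXi[OF h]]
  by (rule tempered_comp)

lemma dist_tensor_add: "dist_tensor (u + v) h = dist_tensor u h + dist_tensor v h"
  by (rule ext) (simp add: dist_tensor_def)

lemma dist_tensor_cscale: "dist_tensor (cscale c u) h = cscale c (dist_tensor u h)"
  by (rule ext) (simp add: dist_tensor_def)

text \<open>The partial integral of a tensor product is a constant times its first factor, so
  homogeneity of \<open>u\<close> suffices.\<close>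

lemma dist_tensor_apply_tensor:
  assumes u: "u \<in> tempered" and f: "f \<in> schwartz" and g: "g \<in> schwartz"
  shows "dist_tensor u h (tensor f g) = (LINT Y|dXi. g Y * h Y) * u f"
proof -
  have "partial_integral dXi h (tensor f g) X = f X * (LINT Y|dXi. g Y * h Y)" for X
    by (simp only: partial_integral_def tensor_def prod.case mult.assoc integral_mult_right_zero)
  then have "partial_integral dXi h (tensor f g) = cscale (LINT Y|dXi. g Y * h Y) f"
    by (intro ext) (simp only: mult.commute)
  then show ?thesis
    using tensor_schwartz(1)[OF g] f tempered_cscale[OF u f]
    unfolding dist_tensor_partial_integral by simp
qed

end

lemma tempered_isoE:
  assumes "tempered_iso T"
  obtains S where "clinear_on tempered T" "continuous_map tempered_topology tempered_topology S"
    "\<And>u. u \<in> tempered \<Longrightarrow> T u \<in> tempered" "\<And>u. u \<in> tempered \<Longrightarrow> S u \<in> tempered"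
    "\<And>u. u \<in> tempered \<Longrightarrow> S (T u) = u" "\<And>u. u \<in> tempered \<Longrightarrow> T (S u) = u"
proof -
  from assms have lin: "clinear_on tempered T"
    and hom: "homeomorphic_map tempered_topology tempered_topology T"
    by (simp_all add: tempered_iso_def)
  from hom obtain S where "homeomorphic_maps tempered_topology tempered_topology T S"
    unfolding homeomorphic_map_maps by blast
  then have ST: "continuous_map tempered_topology tempered_topology T"
      "continuous_map tempered_topology tempered_topology S"
      "\<forall>u\<in>tempered. S (T u) = u" "\<forall>u\<in>tempered. T (S u) = u"
    by (simp_all add: homeomorphic_maps_def)
  then have "T ` tempered \<subseteq> tempered" "S ` tempered \<subseteq> tempered"
    using continuous_map_image_subset_topspace by fastforce+
  then show ?thesis using that[OF lin ST(2)] ST(3,4) by blast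
qed

section \<open>The space induced by an isomorphism \<open>T\<close> with inverse \<open>S\<close>,
  for later use with both \<open>M\<close> and \<open>MM\<close>\<close>

context
  fixes h :: "'n::finite phase_fun" and L :: "'n phase2_dist set" and \<nu> :: "'n phase2_dist \<Rightarrow> real"
    and T S :: "'n phase2_dist \<Rightarrow> 'n phase2_dist"
  assumes h: "h \<in> schwartz" "h \<noteq> 0"
    and L: "banach_on L \<nu>" "continuously_embedded L \<nu> tempered_topology"
    and T: "clinear_on tempered T" "\<And>u. u \<in> tempered \<Longrightarrow> T u \<in> tempered"
    and S: "continuous_map tempered_topology tempered_topology S"
      "\<And>u. u \<in> tempered \<Longrightarrow> S u \<in> tempered"
    and ST: "\<And>u. u \<in> tempered \<Longrightarrow> S (T u) = u" "\<And>u. u \<in> tempered \<Longrightarrow> T (S u) = u"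
begin

private abbreviation J where "J u \<equiv> T (dist_tensor u h)"
private abbreviation c where "c \<equiv> LINT Y|dXi. (cnj \<circ> h) Y * h Y"

lemma L2_factor_nonzero: "c \<noteq> 0"
  by (rule schwartz_L2_norm_nonzero[OF h])

lemma induced_map_add:
  assumes "u \<in> tempered" "v \<in> tempered"
  shows "J (u + v) = J u + J v"
  unfolding dist_tensor_add[OF h(1)]
  using T(1) dist_tensor_tempered[OF h(1)] assms unfolding clinear_on_def by blast

lemma induced_map_cscale:
  assumes "u \<in> tempered"
  shows "J (cscale a u) = cscale a (J u)"
  unfolding dist_tensor_cscale[OF h(1)]
  using T(1) dist_tensor_tempered[OF h(1)] assms unfolding clinear_on_def by blast

lemma induced_map_zero: "J 0 = 0"
proof -
  have "0 \<in> (tempered :: 'n phase_dist set)" using tempered_subspace by (rule cfun.subspace_0)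
  then have "J (cscale 0 0) = cscale 0 (J 0)" by (rule induced_map_cscale)
  moreover have "cscale 0 (0 :: 'n phase_dist) = 0" "cscale 0 (J 0) = 0"
    by (rule ext, simp)+
  ultimately show ?thesis by metis
qed

lemma induced_map_diff:
  assumes "u \<in> tempered" "v \<in> tempered"
  shows "J (u - v) = J u - J v"
proof -
  have cv: "cscale (-1) v \<in> tempered" using tempered_subspace assms(2) by (rule cfun.subspace_scale)
  have "u - v = u + cscale (-1) v" by (rule ext) simp
  then have "J (u - v) = J u + cscale (-1) (J v)"
    using induced_map_add[OF assms(1) cv] induced_map_cscale[OF assms(2), of "-1"] by metis
  also have "\<dots> = J u - J v" by (rule ext) simp
  finally show ?thesis .
qed

text \<open>Testing \<open>u \<otimes> h\<close> against \<open>f \<otimes> cnj h\<close> recovers \<open>u\<close> up to the factor \<open>c\<close>.\<close>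

lemma inverse_induced_map_apply:
  assumes "u \<in> tempered" "f \<in> schwartz"
  shows "S (J u) (tensor f (cnj \<circ> h)) = c * u f"
  using ST(1)[OF dist_tensor_tempered[OF h(1) assms(1)]]
    dist_tensor_apply_tensor[OF h(1) assms schwartz_cnj[OF h(1)]] by metis

text \<open>Definiteness of the induced norm: \<open>J u\<close> determines \<open>c * u f\<close>
  for every Schwartz \<open>f\<close>, and \<open>c\<close> is not zero.\<close>

lemma induced_map_eq_0_iff:
  assumes u: "u \<in> tempered"
  shows "J u = 0 \<longleftrightarrow> u = 0"
proof
  assume 0: "J u = 0"
  have z: "0 \<in> (tempered :: 'n phase_dist set)" using tempered_subspace by (rule cfun.subspace_0)
  show "u = 0"
  proof
    fix f
    show "u f = 0 f"
    proof (cases "f \<in> schwartz")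
      case True
      have "c * u f = c * 0 f"
        using inverse_induced_map_apply[OF u True] inverse_induced_map_apply[OF z True] 0 induced_map_zero by metis
      then show ?thesis using L2_factor_nonzero by simp
    qed (simp add: tempered_outside[OF u])
  qed
qed (use induced_map_zero in metis)

lemma cnorm_on_target: "cnorm_on L \<nu>"
  using L(1) by (simp add: banach_on_def)

lemma cnorm_on_induced: "cnorm_on (induced_space L T h) (induced_norm \<nu> T h)"
proof -
  note N = cnorm_onD[OF cnorm_on_target]
  have LD: "0 \<in> L" "\<And>u v. u \<in> L \<Longrightarrow> v \<in> L \<Longrightarrow> u + v \<in> L" "\<And>a u. u \<in> L \<Longrightarrow> cscale a u \<in> L"
    using N(1) by (auto simp: cfun.subspace_def)
  have TD: "0 \<in> (tempered :: 'n phase_dist set)"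
    "\<And>u v :: 'n phase_dist. u \<in> tempered \<Longrightarrow> v \<in> tempered \<Longrightarrow> u + v \<in> tempered"
    "\<And>a (u :: 'n phase_dist). u \<in> tempered \<Longrightarrow> cscale a u \<in> tempered"
    using tempered_subspace by (auto simp: cfun.subspace_def)
  have V: "u \<in> induced_space L T h \<longleftrightarrow> u \<in> tempered \<and> J u \<in> L" for u
    by (simp add: induced_space_def)
  show ?thesis
    unfolding cnorm_on_def
  proof (intro conjI ballI allI)
    show "cfun.subspace (induced_space L T h)"
      unfolding cfun.subspace_def
    proof (intro conjI ballI allI)
      show "0 \<in> induced_space L T h" unfolding V using LD(1) TD(1) induced_map_zero by metis
      fix u assume u: "u \<in> induced_space L T h"
      show "cscale a u \<in> induced_space L T h" for a
        using u induced_map_cscale[of u a] LD(3)[of "J u" a] TD(3)[of u a] unfolding V by metis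
      fix v assume v: "v \<in> induced_space L T h"
      show "u + v \<in> induced_space L T h"
        using u v induced_map_add[of u v] LD(2)[of "J u" "J v"] TD(2)[of u v] unfolding V by metis
    qed
    fix u assume "u \<in> induced_space L T h"
    then have u: "u \<in> tempered" "J u \<in> L" by (simp_all add: V)
    show "0 \<le> induced_norm \<nu> T h u" unfolding induced_norm_def using u(2) by (rule N(2))
    show "induced_norm \<nu> T h u = 0 \<longleftrightarrow> u = 0"
      unfolding induced_norm_def N(3)[OF u(2)] using u(1) by (rule induced_map_eq_0_iff)
    show "induced_norm \<nu> T h (cscale a u) = cmod a * induced_norm \<nu> T h u" for a
      unfolding induced_norm_def induced_map_cscale[OF u(1)] using u(2) by (rule N(4))
    fix v assume "v \<in> induced_space L T h"
    then have v: "v \<in> tempered" "J v \<in> L" by (simp_all add: V)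
    show "induced_norm \<nu> T h (u + v) \<le> induced_norm \<nu> T h u + induced_norm \<nu> T h v"
      unfolding induced_norm_def induced_map_add[OF u(1) v(1)] using u(2) v(2) by (rule N(5))
  qed
qed

text \<open>Three continuous maps are chained: the embedding of \<open>L\<close>, the inverse
  \<open>S\<close>, and evaluation at \<open>F\<close>. The limit \<open>w\<close> need not be of
  the form \<open>J u\<close>, which is the situation met in the completeness proof.\<close>

lemma dist_tensor_limit_apply:
  assumes s: "\<And>n. s n \<in> induced_space L T h" and w: "w \<in> L"
    and lim: "(\<lambda>n. \<nu> (J (s n) - w)) \<longlonglongrightarrow> 0" and F: "F \<in> schwartz"
  shows "(\<lambda>n. dist_tensor (s n) h F) \<longlonglongrightarrow> S w F"
proof -
  have s': "s n \<in> tempered" "J (s n) \<in> L" for n using s by (simp_all add: induced_space_def)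
  have "(\<lambda>n. S (J (s n)) F) \<longlonglongrightarrow> S w F"
    using continuous_map_compose[OF S(1) tempered_topology_eval[OF F], unfolded o_def]
    by (rule continuously_embedded_eval[OF cnorm_on_target L(2) s'(2) w lim])
  then show ?thesis using ST(1)[OF dist_tensor_tempered[OF h(1) s'(1)]] by simp
qed

text \<open>The conclusion mentions neither \<open>T\<close> nor \<open>\<nu>\<close>, so limits
  taken in the norms induced by two different isomorphisms can be compared.\<close>

lemma induced_limit_apply:
  assumes s: "\<And>n. s n \<in> induced_space L T h" and u: "u \<in> induced_space L T h"
    and lim: "(\<lambda>n. induced_norm \<nu> T h (s n - u)) \<longlonglongrightarrow> 0"
  shows "(\<lambda>n. s n f) \<longlonglongrightarrow> u f"
proof (cases "f \<in> schwartz")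
  case True
  have s': "s n \<in> tempered" "J (s n) \<in> L" for n using s by (simp_all add: induced_space_def)
  have u': "u \<in> tempered" "J u \<in> L" using u by (simp_all add: induced_space_def)
  let ?F = "tensor f (cnj \<circ> h)"
  have F: "?F \<in> schwartz" using tensor_schwartz(1)[OF schwartz_cnj[OF h(1)]] True by blast
  have app: "dist_tensor v h ?F = c * v f" if "v \<in> tempered" for v
    by (rule dist_tensor_apply_tensor[OF h(1) that True schwartz_cnj[OF h(1)]])
  have "(\<lambda>n. \<nu> (J (s n) - J u)) \<longlonglongrightarrow> 0"
    using lim unfolding induced_norm_def induced_map_diff[OF s'(1) u'(1)] .
  from dist_tensor_limit_apply[OF s u'(2) this F] have "(\<lambda>n. c * s n f) \<longlonglongrightarrow> c * u f"
    unfolding app[OF s'(1)] inverse_induced_map_apply[OF u'(1) True] .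
  from tendsto_mult_left[OF this, of "inverse c"] show ?thesis
    unfolding mult.assoc[symmetric] left_inverse[OF L2_factor_nonzero] mult_1_left .
next
  case False
  have "s n f = 0" for n using s tempered_outside[OF _ False] by (simp add: induced_space_def)
  moreover have "u f = 0" using u tempered_outside[OF _ False] by (simp add: induced_space_def)
  ultimately show ?thesis by simp
qed

text \<open>What has to be shown is that the limit \<open>w\<close> of the images
  \<open>J (s n)\<close> is again an image, i.e. that \<open>S w\<close> has the form
  \<open>dist_tensor u h\<close>.\<close>

lemma banach_on_induced: "banach_on (induced_space L T h) (induced_norm \<nu> T h)"
proof (rule banach_onI[OF cnorm_on_induced])
  fix s :: "nat \<Rightarrow> 'n phase_dist" assume s: "\<And>n. s n \<in> induced_space L T h"
    and Cauchy: "\<forall>e>0. \<exists>N. \<forall>m\<ge>N. \<forall>n\<ge>N. induced_norm \<nu> T h (s m - s n) < e"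
  have s': "s n \<in> tempered" "J (s n) \<in> L" for n using s by (simp_all add: induced_space_def)
  have "\<forall>e>0. \<exists>N. \<forall>m\<ge>N. \<forall>n\<ge>N. \<nu> (J (s m) - J (s n)) < e"
  proof -
    have "induced_norm \<nu> T h (s m - s n) = \<nu> (J (s m) - J (s n))" for m n
      unfolding induced_norm_def using induced_map_diff[OF s'(1)[of m] s'(1)[of n]] by (rule arg_cong)
    with Cauchy show ?thesis by (simp only:)
  qed
  then obtain w where w: "w \<in> L" "(\<lambda>n. \<nu> (J (s n) - w)) \<longlonglongrightarrow> 0"
    by (rule banach_on_limitE[where s = "\<lambda>n. J (s n)", OF L(1) s'(2)])
  have wt: "w \<in> tempered" using L(2) w(1) by (auto simp: continuously_embedded_def)
  have lim: "(\<lambda>n. dist_tensor (s n) h F) \<longlonglongrightarrow> S w F" if "F \<in> schwartz" for F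
    using s w that by (intro dist_tensor_limit_apply) auto
  \<comment> \<open>\<open>inverse_induced_map_apply\<close> forces this choice. As a multiple of a
    transpose of \<open>S w\<close> it is tempered at once.\<close>
  define u where "u = cscale (inverse c) (\<lambda>f. if f \<in> schwartz then S w (tensor f (cnj \<circ> h)) else 0)"
  have add: "tensor (f + g) (cnj \<circ> h) = tensor f (cnj \<circ> h) + tensor g (cnj \<circ> h)" for f g
    by (rule ext) (simp add: tensor_def case_prod_beta distrib_right)
  have scale: "tensor (cscale a f) (cnj \<circ> h) = cscale a (tensor f (cnj \<circ> h))" for a f
    by (rule ext) (simp add: tensor_def case_prod_beta)
  have "(\<lambda>f. if f \<in> schwartz then S w (tensor f (cnj \<circ> h)) else 0) \<in> tempered"
    using S(2)[OF wt] tensor_schwartz(1)[OF schwartz_cnj[OF h(1)]] add scale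
      tensor_schwartz(2)[OF schwartz_cnj[OF h(1)]]
    by (rule tempered_comp)
  then have u: "u \<in> tempered"
    unfolding u_def using tempered_subspace by (intro cfun.subspace_scale)
  have su: "(\<lambda>n. s n f) \<longlonglongrightarrow> u f" if f: "f \<in> schwartz" for f
  proof -
    have F: "tensor f (cnj \<circ> h) \<in> schwartz"
      using tensor_schwartz(1)[OF schwartz_cnj[OF h(1)]] f by blast
    have "(\<lambda>n. c * s n f) \<longlonglongrightarrow> S w (tensor f (cnj \<circ> h))"
      using lim[OF F] unfolding dist_tensor_apply_tensor[OF h(1) s'(1) f schwartz_cnj[OF h(1)]] .
    from tendsto_mult_left[OF this, of "inverse c"] show ?thesis
      unfolding mult.assoc[symmetric] left_inverse[OF L2_factor_nonzero] mult_1_left u_def if_P[OF f] .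
  qed
  \<comment> \<open>Equality is needed for every test function, not only for tensor products. Since
    \<open>partial_integral dXi h F\<close> is itself a Schwartz function, the pointwise convergence
    of \<open>s n\<close> applies to it, and no density argument is required.\<close>
  have "S w = dist_tensor u h"
  proof
    fix F
    show "S w F = dist_tensor u h F"
    proof (cases "F \<in> schwartz")
      case True
      then have "partial_integral dXi h F \<in> schwartz"
        using partial_integral_schwartz(1)[OF sets_dXi schwartz_integrable_dXi[OF h(1)]] by blast
      then have "(\<lambda>n. dist_tensor (s n) h F) \<longlonglongrightarrow> dist_tensor u h F"
        using su True unfolding dist_tensor_partial_integral by simp
      with lim[OF True] show ?thesis by (rule LIMSEQ_unique)
    next
      case False
      then show ?thesis using tempered_outside[OF S(2)[OF wt]] by (simp add: dist_tensor_def)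
    qed
  qed
  then have Ju: "J u = w" using ST(2)[OF wt] by metis
  have "u \<in> induced_space L T h" using u w(1) Ju by (simp add: induced_space_def)
  moreover have "(\<lambda>n. induced_norm \<nu> T h (s n - u)) \<longlonglongrightarrow> 0"
    using w(2) unfolding induced_norm_def induced_map_diff[OF s'(1) u] Ju .
  ultimately show "\<exists>u\<in>induced_space L T h. (\<lambda>n. induced_norm \<nu> T h (s n - u)) \<longlonglongrightarrow> 0" by blast
qed

end

section \<open>Comparison of the two induced spaces\<close>

lemma tempered_iso_bij_betw: "tempered_iso T \<Longrightarrow> bij_betw T tempered tempered"
  using homeomorphic_imp_surjective_map homeomorphic_imp_injective_map
  unfolding tempered_iso_def bij_betw_def by fastforce

text \<open>The bijection carries \<open>MM (dist_tensor f h)\<close> to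
  \<open>M (dist_tensor f h)\<close>. That it maps into \<open>L\<close> gives one inclusion; the
  other combines its surjectivity onto \<open>L\<close> with injectivity of
  \<open>M\<close>.\<close>

lemma induced_space_eq:
  assumes M: "tempered_iso M" and MM: "tempered_iso MM" and L: "L \<subseteq> tempered"
    and bij: "bij_betw (M \<circ> inv_into tempered MM) L L" and h: "h \<in> schwartz"
  shows "induced_space L MM h = induced_space L M h"
proof -
  let ?I = "inv_into tempered MM"
  note bM = tempered_iso_bij_betw[OF M] and bMM = tempered_iso_bij_betw[OF MM]
  have "MM (dist_tensor f h) \<in> L \<longleftrightarrow> M (dist_tensor f h) \<in> L" if "f \<in> tempered" for f
  proof -
    have t: "dist_tensor f h \<in> tempered" by (rule dist_tensor_tempered[OF h that])
    show ?thesis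
    proof
      assume "MM (dist_tensor f h) \<in> L"
      with bij have "(M \<circ> ?I) (MM (dist_tensor f h)) \<in> L" by (rule bij_betw_apply)
      then show "M (dist_tensor f h) \<in> L" using bij_betw_inv_into_left[OF bMM t] by simp
    next
      assume "M (dist_tensor f h) \<in> L"
      then obtain l where l: "l \<in> L" "M (dist_tensor f h) = M (?I l)"
        using bij unfolding bij_betw_def by fastforce
      have lt: "l \<in> tempered" using l(1) L by blast
      have "?I l \<in> tempered" using bij_betw_inv_into[OF bMM] lt by (rule bij_betw_apply)
      with t l(2) have "dist_tensor f h = ?I l"
        using bij_betw_imp_inj_on[OF bM] by (simp add: inj_on_eq_iff)
      then have "MM (dist_tensor f h) = l" using bij_betw_inv_into_right[OF bMM lt] by metis
      then show "MM (dist_tensor f h) \<in> L" using l(1) by metis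
    qed
  qed
  then show ?thesis by (auto simp: induced_space_def)
qed

theorem proposition3p6:
  fixes sharp :: "'n::finite phase_fun \<Rightarrow> 'n phase_fun \<Rightarrow> 'n phase_fun"
    and L :: "'n phase2_dist set" and \<nu> :: "'n phase2_dist \<Rightarrow> real"
    and M MM :: "'n phase2_dist \<Rightarrow> 'n phase2_dist"
  assumes "hypothesis_A sharp" and "hypothesis_B sharp" and "hypothesis_C sharp"
    and "is_modulation_map sharp M"
    and "banach_on L \<nu>" and "continuously_embedded L \<nu> tempered_topology"
    and "tempered_iso MM"
    and "bij_betw (M \<circ> inv_into tempered MM) L L"
  shows "\<forall>h \<in> schwartz - {0}.
    induced_space L MM h = induced_space L M h \<and>
    banach_on (induced_space L MM h) (induced_norm \<nu> MM h) \<and>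
    banach_on (induced_space L M h) (induced_norm \<nu> M h) \<and>
    equivalent_norms_on (induced_space L M h) (induced_norm \<nu> MM h) (induced_norm \<nu> M h)"
proof
  fix h :: "'n phase_fun" assume "h \<in> schwartz - {0}"
  then have h: "h \<in> schwartz" "h \<noteq> 0" by auto
  have M: "tempered_iso M" using assms(4) by (simp add: is_modulation_map_def)
  have L: "L \<subseteq> tempered" using assms(6) by (simp add: continuously_embedded_def)
  obtain S where S: "clinear_on tempered M" "continuous_map tempered_topology tempered_topology S"
    "\<And>u. u \<in> tempered \<Longrightarrow> M u \<in> tempered" "\<And>u. u \<in> tempered \<Longrightarrow> S u \<in> tempered"
    "\<And>u. u \<in> tempered \<Longrightarrow> S (M u) = u" "\<And>u. u \<in> tempered \<Longrightarrow> M (S u) = u"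
    by (rule tempered_isoE[OF M]) (rule that)
  obtain S' where S': "clinear_on tempered MM" "continuous_map tempered_topology tempered_topology S'"
    "\<And>u. u \<in> tempered \<Longrightarrow> MM u \<in> tempered" "\<And>u. u \<in> tempered \<Longrightarrow> S' u \<in> tempered"
    "\<And>u. u \<in> tempered \<Longrightarrow> S' (MM u) = u" "\<And>u. u \<in> tempered \<Longrightarrow> MM (S' u) = u"
    by (rule tempered_isoE[OF assms(7)]) (rule that)
  let ?V = "induced_space L M h" and ?\<nu> = "induced_norm \<nu> M h" and ?\<nu>' = "induced_norm \<nu> MM h"
  have eq: "induced_space L MM h = ?V"
    by (rule induced_space_eq[OF M assms(7) L assms(8) h(1)])
  have B: "banach_on ?V ?\<nu>"
    by (rule banach_on_induced[where T = M and S = S, OF h assms(5,6) S(1,3,2,4,5,6)])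
  have B': "banach_on ?V ?\<nu>'"
    using banach_on_induced[where T = MM and S = S', OF h assms(5,6) S'(1,3,2,4,5,6)] unfolding eq .
  \<comment> \<open>Both kinds of norm convergence imply pointwise convergence of the same sequence
    \<open>s\<close>, and limits of complex numbers are unique.\<close>
  have consistent: "x = y" if "\<And>n. s n \<in> ?V" "x \<in> ?V" "y \<in> ?V"
      and lim: "(\<lambda>n. ?\<nu> (s n - x)) \<longlonglongrightarrow> 0" "(\<lambda>n. ?\<nu>' (s n - y)) \<longlonglongrightarrow> 0" for s x y
  proof
    fix f
    have "(\<lambda>n. s n f) \<longlonglongrightarrow> x f"
      by (rule induced_limit_apply[where T = M and S = S, OF h assms(5,6) S(1,3,2,4,5,6) that(1,2) lim(1)])
    moreover have "(\<lambda>n. s n f) \<longlonglongrightarrow> y f"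
      by (rule induced_limit_apply[where T = MM and S = S',
            OF h assms(5,6) S'(1,3,2,4,5,6) that(1,3)[folded eq] lim(2)])
    ultimately show "x f = y f" by (rule LIMSEQ_unique)
  qed
  have "\<exists>C>0. \<forall>u\<in>?V. ?\<nu>' u \<le> C * ?\<nu> u"
    by (rule banach_on_norm_le[OF B B']) (rule consistent)
  then obtain C where C: "C > 0" "\<forall>u\<in>?V. ?\<nu>' u \<le> C * ?\<nu> u" by blast
  \<comment> \<open>Both norms are complete and the consistency condition is symmetric in them, so
    the roles can be exchanged.\<close>
  have "\<exists>C>0. \<forall>u\<in>?V. ?\<nu> u \<le> C * ?\<nu>' u"
    by (rule banach_on_norm_le[OF B' B]) (rule consistent[symmetric])
  then obtain C' where C': "C' > 0" "\<forall>u\<in>?V. ?\<nu> u \<le> C' * ?\<nu>' u" by blast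
  have "equivalent_norms_on ?V ?\<nu>' ?\<nu>"
    unfolding equivalent_norms_on_def
  proof (intro exI conjI ballI)
    \<comment> \<open>The lower constant comes from dividing the first estimate by \<open>C\<close>;
      the second estimate is already the upper bound.\<close>
    show "0 < 1 / C" "0 < C'" using C C' by simp_all
    fix u assume u: "u \<in> ?V"
    show "1 / C * ?\<nu>' u \<le> ?\<nu> u" using C u by (simp add: divide_le_eq mult.commute)
    show "?\<nu> u \<le> C' * ?\<nu>' u" using C'(2) u by blast
  qed
  with eq B B' show "induced_space L MM h = ?V \<and> banach_on (induced_space L MM h) ?\<nu>' \<and>
      banach_on ?V ?\<nu> \<and> equivalent_norms_on ?V ?\<nu>' ?\<nu>"
    by simp
qed

end
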